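(* Let $E$ be a complex Banach lattice and let $(e^{tA})_{t\ge0}$ be a real, uniformly eventually positive, and persistently irreducible $C_0$-semigroup on $E$. Suppose that there exist $u\in E_+$ and $t_0\ge0$ such that $e^{t_0A}E\subseteq E_u$ and $e^{t_0A}E$ contains a quasi-interior point of $(E_u)_+$. Then $\sigma(A)$ is non-empty.
   Context: $E_+$ is the positive cone. For $u\in E_+$, the principal ideal $E_u:=\{f\in E:\exists c>0,\ |f|\le cu\}$ is a Banach lattice with the gauge norm $\|f\|_u:=\inf\{c>0:|f|\le cu\}$, with positive cone $(E_u)_+=E_u\cap E_+$. An element $v\in F_+$ of a Banach lattice $F$ is a quasi-interior point of $F_+$ if the principal ideal $F_v$ is dense in $F$. A bounded operator on a complex Banach lattice is real if it maps the real part $E_{\mathbb R}$ into itself; a semigroup is real if each $e^{tA}$ is real. The semigroup is uniformly eventually positive if there is $t_1\ge0$ such that $e^{tA}f\ge0$ for all $t\ge t_1$ and all $0\le f\in E$. A (lattice) ideal of $E$ is a subspace $I$ such that $|y|\le|x|$, $x\in I$ implies $y\in I$. The semigroup is persistently irreducible if, whenever $I$ is a closed ideal of $E$ for which there exists $t_1\ge0$ with $e^{tA}I\subseteq I$ for all $t\ge t_1$, one has $I=\{0\}$ or $I=E$. *)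

theory Defs
  imports "HOL-Analysis.Analysis" "HOL-Library.Lattice_Algebras"
begin

section \<open>Complex Banach spaces\<close>

class scaleC =
  fixes scaleC :: "complex \<Rightarrow> 'a \<Rightarrow> 'a" (infixr \<open>*\<^sub>C\<close> 75)

class complex_banach = banach + scaleC +
  assumes scaleC_add_right: "a *\<^sub>C (x + y) = a *\<^sub>C x + a *\<^sub>C y"
    and scaleC_add_left: "(a + b) *\<^sub>C x = a *\<^sub>C x + b *\<^sub>C x"
    and scaleC_scaleC: "a *\<^sub>C b *\<^sub>C x = (a * b) *\<^sub>C x"
    and scaleC_of_real: "complex_of_real r *\<^sub>C x = r *\<^sub>R x"
    and norm_scaleC: "norm (a *\<^sub>C x) = cmod a * norm x"

lemma vector_space_scaleC: "vector_space (scaleC :: complex \<Rightarrow> 'a \<Rightarrow> 'a::complex_banach)"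
proof
  show "1 *\<^sub>C x = x" for x :: 'a
    using scaleC_of_real[of 1 x] by simp
qed (simp_all add: scaleC_add_right scaleC_add_left scaleC_scaleC)

abbreviation csubspace :: "'a::complex_banach set \<Rightarrow> bool"
  where "csubspace \<equiv> module.subspace scaleC"

definition bounded_clinear :: "('a::complex_banach \<Rightarrow> 'b::complex_banach) \<Rightarrow> bool"
  where "bounded_clinear f \<longleftrightarrow> bounded_linear f \<and> Vector_Spaces.linear scaleC scaleC f"


section \<open>Semigroups, generators and spectra\<close>

text \<open>Operator families are functions on all of \<open>real\<close>; only their values at
  \<open>t \<ge> 0\<close> are ever constrained or used.\<close>

definition C0_semigroup :: "(real \<Rightarrow> 'a::complex_banach \<Rightarrow> 'a) \<Rightarrow> bool"
  where "C0_semigroup T \<longleftrightarrow>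
    (\<forall>t\<ge>0. bounded_clinear (T t)) \<and>
    T 0 = id \<and>
    (\<forall>s\<ge>0. \<forall>t\<ge>0. T (s + t) = T s \<circ> T t) \<and>
    (\<forall>x. ((\<lambda>t. T t x) \<longlongrightarrow> x) (at_right 0))"

definition generator_domain :: "(real \<Rightarrow> 'a::complex_banach \<Rightarrow> 'a) \<Rightarrow> 'a set"
  where "generator_domain T =
    {x. \<exists>y. ((\<lambda>h. (1 / h) *\<^sub>R (T h x - x)) \<longlongrightarrow> y) (at_right 0)}"

definition generator :: "(real \<Rightarrow> 'a::complex_banach \<Rightarrow> 'a) \<Rightarrow> 'a \<Rightarrow> 'a"
  where "generator T x = Lim (at_right 0) (\<lambda>h. (1 / h) *\<^sub>R (T h x - x))"

text \<open>An unbounded operator is given by its domain \<open>D\<close> and a function \<open>A\<close> whose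
  values outside \<open>D\<close> are irrelevant.\<close>

definition resolvent_set :: "'a::complex_banach set \<Rightarrow> ('a \<Rightarrow> 'a) \<Rightarrow> complex set"
  where "resolvent_set D A =
    {\<mu>. bij_betw (\<lambda>x. \<mu> *\<^sub>C x - A x) D UNIV \<and>
         bounded_clinear (inv_into D (\<lambda>x. \<mu> *\<^sub>C x - A x))}"

definition spectrum :: "'a::complex_banach set \<Rightarrow> ('a \<Rightarrow> 'a) \<Rightarrow> complex set"
  where "spectrum D A = - resolvent_set D A"


section \<open>Real Banach lattices\<close>

class banach_lattice = banach + ordered_real_vector + lattice_ab_group_add_abs +
  assumes norm_mono_abs: "\<bar>x\<bar> \<le> \<bar>y\<bar> \<Longrightarrow> norm x \<le> norm y"

instance real :: banach_lattice
  by standard (auto simp: sup_real_def)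

text \<open>The elements \<open>cos \<theta> x + sin \<theta> y\<close> below are the real parts of the rotations of \<open>x + i y\<close>;
  their least upper bound is the modulus of \<open>x + i y\<close>.\<close>

definition rot :: "'a::real_vector \<Rightarrow> 'a \<Rightarrow> real \<Rightarrow> 'a"
  where "rot x y \<theta> = cos \<theta> *\<^sub>R x + sin \<theta> *\<^sub>R y"

definition is_modulus :: "'a::banach_lattice \<Rightarrow> 'a \<Rightarrow> 'a \<Rightarrow> bool"
  where "is_modulus x y s \<longleftrightarrow>
    (\<forall>\<theta>. rot x y \<theta> \<le> s) \<and> (\<forall>w. (\<forall>\<theta>. rot x y \<theta> \<le> w) \<longrightarrow> s \<le> w)"

definition modulus :: "'a::banach_lattice \<Rightarrow> 'a \<Rightarrow> 'a"
  where "modulus x y = (THE s. is_modulus x y s)"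

lemma norm_abs_eq: "norm \<bar>x\<bar> = norm (x::'a::banach_lattice)"
  by (intro antisym norm_mono_abs) auto

lemma norm_mono_nonneg: "0 \<le> x \<Longrightarrow> x \<le> y \<Longrightarrow> norm x \<le> norm (y::'a::banach_lattice)"
  by (rule norm_mono_abs) (simp add: abs_of_nonneg)

lemma LIMSEQ_nonneg:
  fixes X :: "nat \<Rightarrow> 'a::banach_lattice"
  assumes X: "X \<longlonglongrightarrow> x" and nonneg: "\<And>n. 0 \<le> X n"
  shows "0 \<le> x"
proof -
  define m where "m = sup (- x) 0"
  have m0: "0 \<le> m" by (simp add: m_def)
  have "m \<le> \<bar>X n - x\<bar>" for n
  proof -
    have "- x \<le> X n - x" using nonneg[of n] by simp
    also have "\<dots> \<le> \<bar>X n - x\<bar>" by (rule abs_ge_self)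
    finally show ?thesis unfolding m_def by simp
  qed
  then have "norm m \<le> norm (X n - x)" for n
    using norm_mono_nonneg[OF m0] norm_abs_eq by metis
  moreover have "(\<lambda>n. norm (X n - x)) \<longlonglongrightarrow> 0"
    using X by (simp add: LIM_zero_iff tendsto_norm_zero)
  ultimately have "norm m \<le> 0" by (meson LIMSEQ_le_const)
  then have "m = 0" by simp
  then have "- x \<le> 0" unfolding m_def by (metis sup.cobounded1)
  then show ?thesis by simp
qed

lemma LIMSEQ_le_banach_lattice:
  fixes X :: "nat \<Rightarrow> 'a::banach_lattice"
  assumes "X \<longlonglongrightarrow> x" "Y \<longlonglongrightarrow> y" "\<And>n. X n \<le> Y n"
  shows "x \<le> y"
  using LIMSEQ_nonneg[of "\<lambda>n. Y n - X n" "y - x"] tendsto_diff[OF assms(2,1)] assms(3) by simp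

lemma scaleR_le_abs: "c *\<^sub>R x \<le> \<bar>c\<bar> *\<^sub>R \<bar>x\<bar>" for x :: "'a::banach_lattice"
proof (cases "0 \<le> c")
  case True
  then show ?thesis by (simp add: scaleR_left_mono abs_ge_self)
next
  case False
  then have "(- c) *\<^sub>R (- x) \<le> (- c) *\<^sub>R \<bar>x\<bar>"
    by (intro scaleR_left_mono) (auto simp: abs_ge_minus_self)
  with False show ?thesis by simp
qed

lemma rot_lipschitz:
  fixes x y :: "'a::banach_lattice"
  shows "rot x y \<theta> \<le> rot x y \<phi> + \<bar>\<theta> - \<phi>\<bar> *\<^sub>R (\<bar>x\<bar> + \<bar>y\<bar>)"
proof -
  have lip: "\<bar>f \<theta> - f \<phi>\<bar> \<le> \<bar>\<theta> - \<phi>\<bar>"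
    if "\<And>t. (f has_real_derivative f' t) (at t)" "\<And>t. \<bar>f' t\<bar> \<le> 1" for f f' :: "real \<Rightarrow> real"
    using field_differentiable_bound[of UNIV f f' 1 \<theta> \<phi>] that by auto
  have c: "\<bar>cos \<theta> - cos \<phi>\<bar> \<le> \<bar>\<theta> - \<phi>\<bar>"
    by (rule lip[of cos "\<lambda>t. - sin t"]) (auto intro!: derivative_eq_intros)
  have s: "\<bar>sin \<theta> - sin \<phi>\<bar> \<le> \<bar>\<theta> - \<phi>\<bar>"
    by (rule lip[of sin cos]) (auto intro!: derivative_eq_intros)
  have "rot x y \<theta> - rot x y \<phi> = (cos \<theta> - cos \<phi>) *\<^sub>R x + (sin \<theta> - sin \<phi>) *\<^sub>R y"
    by (simp add: rot_def algebra_simps)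
  also have "\<dots> \<le> \<bar>cos \<theta> - cos \<phi>\<bar> *\<^sub>R \<bar>x\<bar> + \<bar>sin \<theta> - sin \<phi>\<bar> *\<^sub>R \<bar>y\<bar>"
    by (intro add_mono scaleR_le_abs)
  also have "\<dots> \<le> \<bar>\<theta> - \<phi>\<bar> *\<^sub>R \<bar>x\<bar> + \<bar>\<theta> - \<phi>\<bar> *\<^sub>R \<bar>y\<bar>"
    by (intro add_mono scaleR_right_mono c s) auto
  finally show ?thesis by (simp add: algebra_simps)
qed

lemma ex_is_modulus: "\<exists>s. is_modulus x (y::'a::banach_lattice) s"
proof -
  define b where "b = \<bar>x\<bar> + \<bar>y\<bar>"
  have b0: "0 \<le> b" by (simp add: b_def)
  define G where "G n = (\<lambda>k. rot x y (real k / real (Suc n))) ` {.. 7 * Suc n}" for n :: nat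
  define S where "S n = Sup_fin (G n)" for n
  have fin: "finite (G n)" "G n \<noteq> {}" for n by (auto simp: G_def)
  have approx: "rot x y \<theta> \<le> S n + inverse (real (Suc n)) *\<^sub>R b" for \<theta> n
  proof -
    obtain \<phi> where \<phi>: "0 \<le> \<phi>" "\<phi> < 2 * pi" "cos \<theta> = cos \<phi>" "sin \<theta> = sin \<phi>"
      using sincos_total_2pi[of "cos \<theta>" "sin \<theta>"] by auto
    define k where "k = nat \<lfloor>\<phi> * real (Suc n)\<rfloor>"
    have nn: "0 \<le> \<phi> * real (Suc n)" using \<phi> by simp
    have k: "real k \<le> \<phi> * real (Suc n)" "\<phi> * real (Suc n) < real k + 1"
      using nn unfolding k_def by linarith+
    have "\<phi> < 7" using \<phi> pi_less_4 pi_approx by (simp; linarith)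
    then have "\<phi> * real (Suc n) \<le> 7 * real (Suc n)" by (intro mult_right_mono) auto
    with k have "real k \<le> real (7 * Suc n)" by simp
    then have "k \<le> 7 * Suc n" by (simp only: of_nat_le_iff)
    then have "rot x y (real k / real (Suc n)) \<in> G n" unfolding G_def by auto
    then have le: "rot x y (real k / real (Suc n)) \<le> S n"
      unfolding S_def by (intro Sup_fin.coboundedI fin)
    have "\<phi> - real k / real (Suc n) = (\<phi> * real (Suc n) - real k) / real (Suc n)"
      by (simp add: field_simps)
    then have d: "\<bar>\<phi> - real k / real (Suc n)\<bar> \<le> inverse (real (Suc n))"
      using k by (simp add: divide_simps)
    have "rot x y \<theta> = rot x y \<phi>" using \<phi> by (simp add: rot_def)
    also have "\<dots> \<le> rot x y (real k / real (Suc n)) + \<bar>\<phi> - real k / real (Suc n)\<bar> *\<^sub>R b"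
      unfolding b_def by (rule rot_lipschitz)
    also have "\<dots> \<le> S n + inverse (real (Suc n)) *\<^sub>R b"
      by (intro add_mono le scaleR_right_mono d b0)
    finally show ?thesis .
  qed
  have S_le: "S n \<le> w" if "\<And>\<theta>. rot x y \<theta> \<le> w" for n w
    unfolding S_def using that by (intro Sup_fin.boundedI fin) (auto simp: G_def)
  have SS: "S m - S n \<le> inverse (real (Suc n)) *\<^sub>R b" for m n
    using S_le[OF approx[of _ n], of m] by (simp add: algebra_simps)
  have "norm (S m - S n) \<le> (inverse (real (Suc m)) + inverse (real (Suc n))) * norm b" for m n
  proof -
    let ?c = "inverse (real (Suc m)) + inverse (real (Suc n))"
    have 1: "S m - S n \<le> ?c *\<^sub>R b"
      by (rule order_trans[OF SS[of m n]]) (intro scaleR_right_mono b0, simp)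
    have 2: "- (S m - S n) \<le> ?c *\<^sub>R b"
      using order_trans[OF SS[of n m] scaleR_right_mono[OF _ b0, of _ ?c]] by simp
    have "\<bar>S m - S n\<bar> \<le> \<bar>?c *\<^sub>R b\<bar>"
      using 1 2 by (meson abs_leI abs_ge_self order_trans)
    from norm_mono_abs[OF this] show ?thesis by simp
  qed
  note bound = this
  have lim0: "(\<lambda>n. inverse (real (Suc n))) \<longlonglongrightarrow> 0" by (rule LIMSEQ_inverse_real_of_nat)
  have "Cauchy S"
  proof (rule CauchyI)
    fix e :: real assume e: "0 < e"
    have "(\<lambda>n. 2 * (inverse (real (Suc n)) * norm b)) \<longlonglongrightarrow> 2 * (0 * norm b)"
      by (intro tendsto_intros lim0)
    then have "\<forall>\<^sub>F n in sequentially. 2 * (inverse (real (Suc n)) * norm b) < e"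
      using e by (intro order_tendstoD(2)) auto
    then obtain M where M: "\<And>n. n \<ge> M \<Longrightarrow> 2 * (inverse (real (Suc n)) * norm b) < e"
      by (auto simp: eventually_sequentially)
    show "\<exists>M. \<forall>m\<ge>M. \<forall>n\<ge>M. norm (S m - S n) < e"
    proof (intro exI allI impI)
      fix m n assume mn: "M \<le> m" "M \<le> n"
      show "norm (S m - S n) < e"
        using bound[of m n] M[OF mn(1)] M[OF mn(2)] by (simp add: distrib_right)
    qed
  qed
  then obtain s where s: "S \<longlonglongrightarrow> s" using Cauchy_convergent convergent_def by blast
  have "is_modulus x y s"
    unfolding is_modulus_def
  proof (intro conjI allI impI)
    fix \<theta>
    have "(\<lambda>n. S n + inverse (real (Suc n)) *\<^sub>R b) \<longlonglongrightarrow> s + 0 *\<^sub>R b"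
      by (intro tendsto_intros s lim0)
    then show "rot x y \<theta> \<le> s"
      using LIMSEQ_le_banach_lattice[OF tendsto_const _ approx] by simp
  next
    fix w assume "\<forall>\<theta>. rot x y \<theta> \<le> w"
    then show "s \<le> w"
      by (intro LIMSEQ_le_banach_lattice[OF s tendsto_const] S_le) auto
  qed
  then show ?thesis by blast
qed

lemma is_modulus_modulus: "is_modulus x y (modulus x y)"
proof -
  have "\<exists>!s. is_modulus x y s"
    using ex_is_modulus[of x y] by (auto simp: is_modulus_def intro: antisym)
  then show ?thesis unfolding modulus_def by (rule theI')
qed

lemma rot_le_modulus: "rot x y \<theta> \<le> modulus x y"
  using is_modulus_modulus[of x y] by (simp add: is_modulus_def)

lemma modulus_leI: "(\<And>\<theta>. rot x y \<theta> \<le> w) \<Longrightarrow> modulus x y \<le> w"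
  using is_modulus_modulus[of x y] by (simp add: is_modulus_def)

lemma abs_rot_le_modulus: "\<bar>rot x y \<theta>\<bar> \<le> modulus x y"
proof (rule abs_leI)
  show "- rot x y \<theta> \<le> modulus x y"
    using rot_le_modulus[of x y "\<theta> + pi"] by (simp add: rot_def)
qed (rule rot_le_modulus)

lemma modulus_nonneg: "0 \<le> modulus x y"
  using order_trans[OF abs_ge_zero abs_rot_le_modulus] .

lemma abs_le_modulus: "\<bar>x\<bar> \<le> modulus x y" "\<bar>y\<bar> \<le> modulus x y"
  using abs_rot_le_modulus[of x y 0] abs_rot_le_modulus[of x y "pi / 2"] by (simp_all add: rot_def)

lemma modulus_le_sum: "modulus x y \<le> \<bar>x\<bar> + \<bar>y\<bar>"
proof (rule modulus_leI)
  fix \<theta>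
  have "rot x y \<theta> \<le> \<bar>cos \<theta>\<bar> *\<^sub>R \<bar>x\<bar> + \<bar>sin \<theta>\<bar> *\<^sub>R \<bar>y\<bar>"
    unfolding rot_def by (intro add_mono scaleR_le_abs)
  also have "\<dots> \<le> 1 *\<^sub>R \<bar>x\<bar> + 1 *\<^sub>R \<bar>y\<bar>"
    by (intro add_mono scaleR_right_mono) auto
  finally show "rot x y \<theta> \<le> \<bar>x\<bar> + \<bar>y\<bar>" by simp
qed

lemma modulus_triangle: "modulus (x + x') (y + y') \<le> modulus x y + modulus x' y'"
proof (rule modulus_leI)
  fix \<theta>
  have "rot (x + x') (y + y') \<theta> = rot x y \<theta> + rot x' y' \<theta>"
    by (simp add: rot_def algebra_simps)
  also have "\<dots> \<le> modulus x y + modulus x' y'" by (intro add_mono rot_le_modulus)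
  finally show "rot (x + x') (y + y') \<theta> \<le> modulus x y + modulus x' y'" .
qed

lemma modulus_scale_le:
  "modulus (Re c *\<^sub>R x - Im c *\<^sub>R y) (Re c *\<^sub>R y + Im c *\<^sub>R x) \<le> cmod c *\<^sub>R modulus x y"
proof (rule modulus_leI)
  fix \<theta>
  obtain r \<alpha> where c: "c = rcis r \<alpha>" "cmod c = r" "0 \<le> r"
    by (metis rcis_cmod_Arg norm_ge_zero)
  have "rot (Re c *\<^sub>R x - Im c *\<^sub>R y) (Re c *\<^sub>R y + Im c *\<^sub>R x) \<theta> = r *\<^sub>R rot x y (\<theta> - \<alpha>)"
    by (simp add: rot_def c(1) cos_diff sin_diff algebra_simps)
  also have "\<dots> \<le> r *\<^sub>R modulus x y"
    using c by (intro scaleR_left_mono rot_le_modulus) auto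
  finally show "rot (Re c *\<^sub>R x - Im c *\<^sub>R y) (Re c *\<^sub>R y + Im c *\<^sub>R x) \<theta> \<le> cmod c *\<^sub>R modulus x y"
    by (simp add: c)
qed


section \<open>Complex Banach lattices\<close>

text \<open>A complex Banach lattice is the complexification \<open>E\<^sub>R + i E\<^sub>R\<close> of a real Banach lattice
  \<open>E\<^sub>R\<close> (the type \<open>'a\<close> below), with norm \<open>\<parallel>z\<parallel> = \<parallel> |z| \<parallel>\<close>. The modulus \<open>|z|\<close> is taken in the
  complexification itself, so that \<open>|z| \<le> c u\<close> makes sense for \<open>u\<close> in the complexification.\<close>

datatype 'a complexification = Cplx (re: 'a) (im: 'a)

lemma complexification_eq_iff: "z = w \<longleftrightarrow> re z = re w \<and> im z = im w"
  by (cases z; cases w) simp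

instantiation complexification :: (banach_lattice) "{real_normed_vector, scaleC}"
begin

definition "0 = (Cplx 0 0 :: 'a complexification)"
definition "z + w = Cplx (re z + re w) (im z + im w)" for z w :: "'a complexification"
definition "z - w = Cplx (re z - re w) (im z - im w)" for z w :: "'a complexification"
definition "- z = Cplx (- re z) (- im z)" for z :: "'a complexification"
definition "r *\<^sub>R z = Cplx (r *\<^sub>R re z) (r *\<^sub>R im z)" for z :: "'a complexification"
definition "c *\<^sub>C z = Cplx (Re c *\<^sub>R re z - Im c *\<^sub>R im z) (Re c *\<^sub>R im z + Im c *\<^sub>R re z)"
  for z :: "'a complexification"
definition "norm z = norm (modulus (re z) (im z))" for z :: "'a complexification"
definition "sgn z = inverse (norm z) *\<^sub>R z" for z :: "'a complexification"
definition "dist z w = norm (z - w)" for z w :: "'a complexification"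
definition uniformity_complexification :: "('a complexification \<times> 'a complexification) filter"
  where "uniformity_complexification = (INF e\<in>{0 <..}. principal {(x, y). dist x y < e})"
definition open_complexification :: "'a complexification set \<Rightarrow> bool"
  where "open_complexification U \<longleftrightarrow> (\<forall>x\<in>U. eventually (\<lambda>(x', y). x' = x \<longrightarrow> y \<in> U) uniformity)"

lemma re_im_simps [simp]:
  fixes z w :: "'a complexification"
  shows "re 0 = (0::'a)" "im 0 = (0::'a)"
    "re (z + w) = re z + re w" "im (z + w) = im z + im w"
    "re (z - w) = re z - re w" "im (z - w) = im z - im w"
    "re (- z) = - re z" "im (- z) = - im z"
    "re (r *\<^sub>R z) = r *\<^sub>R re z" "im (r *\<^sub>R z) = r *\<^sub>R im z"
    "re (c *\<^sub>C z) = Re c *\<^sub>R re z - Im c *\<^sub>R im z" "im (c *\<^sub>C z) = Re c *\<^sub>R im z + Im c *\<^sub>R re z"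
  by (simp_all add: zero_complexification_def plus_complexification_def minus_complexification_def
      uminus_complexification_def scaleR_complexification_def scaleC_complexification_def)

lemma norm_scaleC_complexification: "norm (c *\<^sub>C z) = cmod c * norm z" for z :: "'a complexification"
proof -
  have le: "norm (c *\<^sub>C z) \<le> cmod c * norm z" for c and z :: "'a complexification"
  proof -
    have "norm (c *\<^sub>C z) \<le> norm (cmod c *\<^sub>R modulus (re z) (im z))"
      unfolding norm_complexification_def re_im_simps
      by (intro norm_mono_nonneg modulus_nonneg modulus_scale_le)
    then show ?thesis by (simp add: norm_complexification_def)
  qed
  show ?thesis
  proof (cases "c = 0")
    case True
    then show ?thesis using le[of c z]
      by (metis antisym mult_zero_left norm_complexification_def norm_ge_zero norm_zero)
  next
    case False
    have "z = inverse c *\<^sub>C c *\<^sub>C z"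
    proof -
      have "z = (inverse c * c) *\<^sub>C z"
        using False by (simp add: complexification_eq_iff)
      also have "\<dots> = inverse c *\<^sub>C c *\<^sub>C z"
        by (simp only: complexification_eq_iff re_im_simps times_complex.sel) (simp add: algebra_simps)
      finally show ?thesis .
    qed
    then have "norm z \<le> cmod (inverse c) * norm (c *\<^sub>C z)" using le by metis
    then have "cmod c * norm z \<le> norm (c *\<^sub>C z)"
      using False unfolding norm_inverse by (simp add: field_simps)
    with le show ?thesis by (intro antisym)
  qed
qed

lemma norm_re_im_le:
  fixes z :: "'a complexification"
  shows "norm (re z) \<le> norm z" "norm (im z) \<le> norm z" "norm z \<le> norm (re z) + norm (im z)"
proof -
  show "norm (re z) \<le> norm z" "norm (im z) \<le> norm z"
    unfolding norm_complexification_def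
    by (metis abs_ge_zero abs_le_modulus norm_abs_eq norm_mono_nonneg)+
  have "norm z \<le> norm (\<bar>re z\<bar> + \<bar>im z\<bar>)"
    unfolding norm_complexification_def
    by (intro norm_mono_nonneg modulus_nonneg modulus_le_sum)
  also have "\<dots> \<le> norm (re z) + norm (im z)"
    by (metis norm_abs_eq norm_triangle_ineq)
  finally show "norm z \<le> norm (re z) + norm (im z)" .
qed

instance
proof
  fix a b :: real and x y z :: "'a complexification" and c d :: complex
  have sR: "complex_of_real r *\<^sub>C z = r *\<^sub>R z" for r and z :: "'a complexification"
    by (simp add: complexification_eq_iff)
  show "(norm x = 0) = (x = 0)"
  proof
    assume "norm x = 0"
    then have "norm (re x) \<le> 0" "norm (im x) \<le> 0" using norm_re_im_le[of x] by auto
    then show "x = 0" by (simp add: complexification_eq_iff)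
  next
    assume "x = 0"
    then have "norm x \<le> 0" using norm_re_im_le(3)[of x] by simp
    moreover have "0 \<le> norm x" by (simp add: norm_complexification_def)
    ultimately show "norm x = 0" by simp
  qed
  show "norm (x + y) \<le> norm x + norm y"
  proof -
    have "norm (x + y) \<le> norm (modulus (re x) (im x) + modulus (re y) (im y))"
      unfolding norm_complexification_def re_im_simps
      by (intro norm_mono_nonneg modulus_nonneg modulus_triangle)
    also have "\<dots> \<le> norm x + norm y"
      unfolding norm_complexification_def by (rule norm_triangle_ineq)
    finally show ?thesis .
  qed
  show "norm (a *\<^sub>R x) = \<bar>a\<bar> * norm x"
    using norm_scaleC_complexification[of "complex_of_real a" x] by (simp add: sR)
qed (simp_all only: sgn_complexification_def dist_complexification_def
    uniformity_complexification_def open_complexification_def,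
    simp_all add: complexification_eq_iff algebra_simps)

end

instance complexification :: (banach_lattice) banach
proof
  fix X :: "nat \<Rightarrow> 'a complexification"
  assume X: "Cauchy X"
  have "Cauchy (\<lambda>n. p (X n))"
    if "\<And>z w. p (z - w) = p z - p w" "\<And>z. norm (p z) \<le> norm z"
    for p :: "'a complexification \<Rightarrow> 'a"
  proof (rule CauchyI)
    fix e :: real assume "0 < e"
    then obtain M where M: "\<And>m n. M \<le> m \<Longrightarrow> M \<le> n \<Longrightarrow> norm (X m - X n) < e"
      using CauchyD[OF X] by metis
    show "\<exists>M. \<forall>m\<ge>M. \<forall>n\<ge>M. norm (p (X m) - p (X n)) < e"
      using M that by (metis order_le_less_trans)
  qed
  from this[of re] this[of im] obtain x y
    where xy: "(\<lambda>n. re (X n)) \<longlonglongrightarrow> x" "(\<lambda>n. im (X n)) \<longlonglongrightarrow> y"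
    using norm_re_im_le by (auto simp: Cauchy_convergent_iff convergent_def)
  have "(\<lambda>n. norm (re (X n) - x) + norm (im (X n) - y)) \<longlonglongrightarrow> 0 + 0"
    using xy by (intro tendsto_add) (simp_all add: LIM_zero tendsto_norm_zero)
  then have lim: "(\<lambda>n. norm (re (X n) - x) + norm (im (X n) - y)) \<longlonglongrightarrow> 0" by simp
  have "norm (X n - Cplx x y) \<le> norm (re (X n) - x) + norm (im (X n) - y)" for n
    using norm_re_im_le(3)[of "X n - Cplx x y"] by simp
  then have "(\<lambda>n. X n - Cplx x y) \<longlonglongrightarrow> 0"
    by (intro Lim_null_comparison[OF _ lim] always_eventually allI)
  then show "convergent X" by (auto simp: convergent_def LIM_zero_iff)
qed

instance complexification :: (banach_lattice) complex_banach
  by standard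
    (simp_all only: complexification_eq_iff re_im_simps norm_scaleC_complexification,
      simp_all add: algebra_simps)

text \<open>\<open>z \<le> w\<close> means that \<open>w - z\<close> is a real positive element; so \<open>0 \<le> z\<close> says that
  \<open>z\<close> belongs to the positive cone.\<close>

instantiation complexification :: (banach_lattice) "{ordered_real_vector, abs}"
begin

definition "z \<le> w \<longleftrightarrow> re z \<le> re w \<and> im z = im w" for z w :: "'a complexification"
definition "z < w \<longleftrightarrow> re z < re w \<and> im z = im w" for z w :: "'a complexification"
definition "\<bar>z\<bar> = Cplx (modulus (re z) (im z)) 0" for z :: "'a complexification"

instance
  by standard
    (auto simp: less_eq_complexification_def less_complexification_def complexification_eq_iff
      intro: scaleR_left_mono scaleR_right_mono)

end

definition real_part :: "'a::banach_lattice complexification set"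
  where "real_part = {z. im z = 0}"

definition pos_cone :: "'a::banach_lattice complexification set"
  where "pos_cone = {z. 0 \<le> z}"

definition lattice_ideal :: "'a::banach_lattice complexification set \<Rightarrow> bool"
  where "lattice_ideal I \<longleftrightarrow> csubspace I \<and> (\<forall>x\<in>I. \<forall>y. \<bar>y\<bar> \<le> \<bar>x\<bar> \<longrightarrow> y \<in> I)"

definition principal_ideal :: "'a::banach_lattice complexification \<Rightarrow> 'a complexification set"
  where "principal_ideal u = {f. \<exists>c>0. \<bar>f\<bar> \<le> c *\<^sub>R u}"

definition gauge_norm ::
    "'a::banach_lattice complexification \<Rightarrow> 'a complexification \<Rightarrow> real"
  where "gauge_norm u f = Inf {c. c > 0 \<and> \<bar>f\<bar> \<le> c *\<^sub>R u}"

text \<open>Here \<open>F\<close> is a subspace of the complexification which, with the inherited order and modulus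
  and with the norm \<open>N\<close>, is itself a Banach lattice (such as \<open>principal_ideal u\<close> with
  \<open>gauge_norm u\<close>). The principal ideal of \<open>v\<close> is formed inside \<open>F\<close>, and density refers to \<open>N\<close>.\<close>

definition quasi_interior_point ::
    "'a::banach_lattice complexification set \<Rightarrow> ('a complexification \<Rightarrow> real) \<Rightarrow>
     'a complexification \<Rightarrow> bool"
  where "quasi_interior_point F N v \<longleftrightarrow>
    v \<in> F \<inter> pos_cone \<and>
    (\<forall>f\<in>F. \<forall>\<epsilon>>0. \<exists>g \<in> F \<inter> principal_ideal v. N (f - g) < \<epsilon>)"

definition real_operator ::
    "('a::banach_lattice complexification \<Rightarrow> 'a complexification) \<Rightarrow> bool"
  where "real_operator S \<longleftrightarrow> S ` real_part \<subseteq> real_part"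

definition real_semigroup ::
    "(real \<Rightarrow> 'a::banach_lattice complexification \<Rightarrow> 'a complexification) \<Rightarrow> bool"
  where "real_semigroup T \<longleftrightarrow> (\<forall>t\<ge>0. real_operator (T t))"

definition uniformly_eventually_positive ::
    "(real \<Rightarrow> 'a::banach_lattice complexification \<Rightarrow> 'a complexification) \<Rightarrow> bool"
  where "uniformly_eventually_positive T \<longleftrightarrow>
    (\<exists>t\<^sub>1\<ge>0. \<forall>t\<ge>t\<^sub>1. \<forall>f\<ge>0. 0 \<le> T t f)"

definition persistently_irreducible ::
    "(real \<Rightarrow> 'a::banach_lattice complexification \<Rightarrow> 'a complexification) \<Rightarrow> bool"
  where "persistently_irreducible T \<longleftrightarrow>
    (\<forall>I. lattice_ideal I \<and> closed I \<and> (\<exists>t\<^sub>1\<ge>0. \<forall>t\<ge>t\<^sub>1. T t ` I \<subseteq> I) \<longrightarrow>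
      I = {0} \<or> I = UNIV)"

end

theory Submission
  imports Defs
begin

text \<open>Suppose \<open>\<sigma>(A)\<close> is empty. Then \<open>R = (0 - A)\<inverse>\<close> is quasinilpotent, and so is every average
  \<open>S = e\<^bsup>sA\<^esup> \<integral>\<^sub>0\<^sup>\<tau> e\<^bsup>tA\<^esup> dt = R e\<^bsup>sA\<^esup> (I - e\<^bsup>\<tau>A\<^esup>)\<close>, because all the factors commute. On the other hand,
  the quasi-interior point gives \<open>e\<^bsup>t\<^sub>0A\<^esup> w \<ge> \<delta> u\<close> with \<open>\<delta> > 0\<close>. By irreducibility the integrals of the orbit
  of \<open>u\<close> over finite time intervals generate a dense ideal; approximating \<open>w\<close> from this ideal
  and using that \<open>e\<^bsup>t\<^sub>0A\<^esup>\<close> is bounded into \<open>E\<^sub>u\<close>, one finds a positive average \<open>S\<close> with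
  \<open>S U \<ge> c U\<close> for some \<open>U > 0\<close> and \<open>c > 0\<close>. Then \<open>S\<^sup>n U \<ge> c\<^sup>n U\<close> contradicts quasinilpotency.\<close>

section \<open>Quasinilpotency from an everywhere defined resolvent\<close>

text \<open>Neither R nor the operators e^{tA} could play the part of S. R is quasinilpotent, but
  nothing makes it positive, since positivity is known only for large times; e^{tA} need not be
  quasinilpotent, because the spectral mapping theorem can fail. S has both virtues: the finite
  window of integration produces the factor R, and the shift by s moves this window into the times
  of positivity. The lower bound for S rests on absorbing an error. Domination of the form |e^{TA}
  x| \<le> K ||x|| U turns closeness in norm of w and its approximant into an order error of at most
  (\<delta>/2) U, so half of \<delta> survives. Irreducibility would be of no use for a semigroup
  that vanishes from some time on, as all ideals would then be invariant; this case has to be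
  excluded separately.\<close>

interpretation cvs: vector_space "scaleC :: complex \<Rightarrow> 'a \<Rightarrow> 'a::complex_banach"
  by (rule vector_space_scaleC)

text \<open>Orthogonality of the characters of Z/N: with \<open>j\<close> and \<open>k\<close>
  swapped in the exponent the sum is geometric with ratio w, where w^N = 1 but w is not 1 if 0 < j <
  N.\<close>

lemma sum_powers_root_of_unity:
  assumes "j < N"
  shows "(\<Sum>k<N. (cis (2 * pi * real k / real N)) ^ j) = (if j = 0 then of_nat N else 0)"
proof (cases "j = 0")
  case False
  define w where "w = cis (2 * pi * real j / real N)"
  have N: "N > 0" using assms by simp
  have "w \<noteq> 1"
  proof
    assume "w = 1"
    then have "cis (2 * pi * real j / real N) = cis (2 * pi * real 0 / real N)"
      by (simp add: w_def)
    then show False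
      using inj_onD[OF bij_betw_imp_inj_on[OF Complex.bij_betw_roots_unity[OF N]], of j 0]
        assms False N by simp
  qed
  moreover have "w ^ N = 1"
    using Complex.bij_betw_roots_unity[OF N] assms unfolding w_def bij_betw_def by blast
  moreover have "cis (2 * pi * real k / real N) ^ j = w ^ k" for k
    unfolding w_def Complex.DeMoivre by (rule arg_cong[of _ _ cis]) simp
  ultimately show ?thesis using False by (simp add: geometric_sum)
qed simp

lemma bounded_clinear_scaleC: "bounded_clinear f \<Longrightarrow> f (c *\<^sub>C x) = c *\<^sub>C f x"
  by (simp add: bounded_clinear_def Vector_Spaces.linear_iff)

lemma bounded_clinear_bounded_linear: "bounded_clinear f \<Longrightarrow> bounded_linear f"
  by (simp add: bounded_clinear_def)

section \<open>An operator R for which I - zR has a bounded inverse G z for every complex z\<close>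

context
  fixes R :: "'a::complex_banach \<Rightarrow> 'a" and G :: "complex \<Rightarrow> 'a \<Rightarrow> 'a"
  assumes R: "bounded_clinear R"
    and G: "\<And>z. bounded_clinear (G z)"
    and G_left: "\<And>z x. G z (x - z *\<^sub>C R x) = x"
    and G_right: "\<And>z x. G z x - z *\<^sub>C R (G z x) = x"
begin

private lemmas R_lin = bounded_clinear_bounded_linear[OF R]
private lemmas G_lin = bounded_clinear_bounded_linear[OF G]

text \<open>Telescoping: I - zR maps the truncated Neumann series to the argument of
  \<open>G z\<close>. No convergence is involved.\<close>

lemma resolvent_powers:
  "G z (x - z ^ N *\<^sub>C (R ^^ N) x) = (\<Sum>j<N. z ^ j *\<^sub>C (R ^^ j) x)"
proof -
  let ?p = "\<lambda>N. \<Sum>j<N. z ^ j *\<^sub>C (R ^^ j) x"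
  have "?p N - z *\<^sub>C R (?p N) = x - z ^ N *\<^sub>C (R ^^ N) x"
  proof (induction N)
    case 0
    then show ?case using R_lin by (simp add: linear_simps)
  next
    case (Suc N)
    have "?p (Suc N) - z *\<^sub>C R (?p (Suc N))
        = (?p N - z *\<^sub>C R (?p N)) + z ^ N *\<^sub>C (R ^^ N) x - z *\<^sub>C z ^ N *\<^sub>C R ((R ^^ N) x)"
      using R_lin by (simp add: linear_simps scaleC_add_right bounded_clinear_scaleC[OF R])
    also have "\<dots> = x - z ^ Suc N *\<^sub>C (R ^^ Suc N) x"
      unfolding Suc.IH by (simp add: scaleC_scaleC)
    finally show ?case .
  qed
  then show ?thesis using G_left[of z "?p N"] by simp
qed

text \<open>Rickart's elementary route to the spectral radius formula: the means of \<open>(I - zR)\<inverse>\<close> over the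
  \<open>N\<close>-th roots of unity times \<open>\<rho>\<close> invert \<open>I - \<rho>\<^sup>N R\<^sup>N\<close>. As \<open>(I - zR)\<inverse>\<close> is uniformly Lipschitz on discs,
  the means for two nearby radii are close, uniformly in \<open>N\<close>; so \<open>\<rho>\<^sup>N R\<^sup>N \<rightarrow> 0\<close> propagates to larger
  radii in steps of fixed size.\<close>

definition circle_mean :: "nat \<Rightarrow> real \<Rightarrow> 'a \<Rightarrow> 'a" where
  "circle_mean N \<rho> x = (1 / real N) *\<^sub>R (\<Sum>k<N. G (of_real \<rho> * cis (2 * pi * real k / real N)) x)"

lemma circle_mean_left_inverse:
  assumes N: "N > 0"
  shows "circle_mean N \<rho> (x - \<rho> ^ N *\<^sub>R (R ^^ N) x) = x"
proof -
  let ?w = "\<lambda>k. cis (2 * pi * real k / real N)"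
  \<comment> \<open>All nodes have the same N-th power, so one vector serves every \<open>k\<close>
    in \<open>resolvent_powers\<close>.\<close>
  have pow: "(of_real \<rho> * ?w k) ^ N = of_real (\<rho> ^ N)" if "k < N" for k
    using Complex.bij_betw_roots_unity[OF N] that by (auto simp: bij_betw_def power_mult_distrib)
  have "G (of_real \<rho> * ?w k) (x - \<rho> ^ N *\<^sub>R (R ^^ N) x)
      = (\<Sum>j<N. (of_real \<rho> ^ j * ?w k ^ j) *\<^sub>C (R ^^ j) x)" if "k < N" for k
    using resolvent_powers[of "of_real \<rho> * ?w k" x N]
    by (simp only: pow[OF that] scaleC_of_real) (simp only: power_mult_distrib)
  then have "circle_mean N \<rho> (x - \<rho> ^ N *\<^sub>R (R ^^ N) x)
      = (1 / real N) *\<^sub>R (\<Sum>k<N. \<Sum>j<N. (of_real \<rho> ^ j * ?w k ^ j) *\<^sub>C (R ^^ j) x)"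
    unfolding circle_mean_def by simp
  also have "(\<Sum>k<N. \<Sum>j<N. (of_real \<rho> ^ j * ?w k ^ j) *\<^sub>C (R ^^ j) x)
      = (\<Sum>j<N. (of_real \<rho> ^ j * (\<Sum>k<N. ?w k ^ j)) *\<^sub>C (R ^^ j) x)"
    by (subst sum.swap) (simp add: sum_distrib_left cvs.scale_sum_left)
  also have "\<dots> = (\<Sum>j<N. if j = 0 then of_nat N *\<^sub>C x else 0)"
    by (rule sum.cong) (simp_all add: sum_powers_root_of_unity)
  also have "\<dots> = of_nat N *\<^sub>C x" using N by simp
  also have "\<dots> = real N *\<^sub>R x" using scaleC_of_real[of "real N" x] by simp
  finally show ?thesis using N by simp
qed

text \<open>Nothing is assumed about how \<open>G z\<close> depends on z. A perturbation argument
  bounds \<open>G w\<close> for w near z, and compactness of the disc leaves finitely many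
  centres.\<close>

lemma resolvent_bounded_on_disc:
  obtains M where "M \<ge> 0" "\<And>z x. cmod z \<le> b \<Longrightarrow> norm (G z x) \<le> M * norm x"
proof -
  obtain K where K: "K > 0" "\<And>x. norm (R x) \<le> norm x * K"
    using bounded_linear.pos_bounded[OF R_lin] by blast
  obtain m where m: "\<And>z. m z > 0" "\<And>z x. norm (G z x) \<le> norm x * m z"
    using bounded_linear.pos_bounded[OF G_lin] by metis
  \<comment> \<open>With this radius the perturbation term costs at most half of the norm of
    \<open>y\<close>, which the left side absorbs.\<close>
  define r where "r z = 1 / (2 * m z * K)" for z
  have r: "r z > 0" for z using m K by (simp add: r_def)
  have local: "norm (G w x) \<le> 2 * m z * norm x" if "w \<in> ball z (r z)" for z w x
  proof -
    define y where "y = G w x"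
    have d: "cmod (w - z) < r z" using that by (simp add: dist_norm norm_minus_commute)
    have "y - z *\<^sub>C R y = x + (w - z) *\<^sub>C R y"
      using G_right[of w x] by (simp add: y_def cvs.scale_left_diff_distrib algebra_simps)
    then have "y = G z (x + (w - z) *\<^sub>C R y)" using G_left[of z y] by simp
    then have "norm y \<le> norm (x + (w - z) *\<^sub>C R y) * m z" using m(2) by metis
    also have "norm (x + (w - z) *\<^sub>C R y) \<le> norm x + r z * (norm y * K)"
      using norm_triangle_ineq[of x "(w - z) *\<^sub>C R y"]
        mult_mono[OF less_imp_le[OF d] K(2)[of y]] r[of z]
      by (simp add: norm_scaleC)
    then have "norm (x + (w - z) *\<^sub>C R y) * m z \<le> (norm x + r z * (norm y * K)) * m z"
      using m(1)[of z] by (intro mult_right_mono) auto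
    also have "\<dots> = norm x * m z + norm y / 2"
      using m(1)[of z] K(1) by (simp add: r_def field_simps)
    finally show ?thesis unfolding y_def[symmetric] by (simp add: mult_ac)
  qed
  obtain C where C: "C \<subseteq> cball 0 b" "finite C" "cball 0 b \<subseteq> (\<Union>z\<in>C. ball z (r z))"
    using compactE_image[OF compact_cball, of "cball 0 b" "\<lambda>z. ball z (r z)" 0 b] r by force
  have "norm (G w x) \<le> (\<Sum>z\<in>C. 2 * m z) * norm x" if w: "cmod w \<le> b" for w x
  proof -
    obtain z where z: "z \<in> C" "w \<in> ball z (r z)" using C(3) w by force
    have "2 * m z \<le> (\<Sum>z\<in>C. 2 * m z)"
      using z(1) C(2) m(1) by (intro member_le_sum) (auto simp: less_imp_le)
    then show ?thesis
      using local[OF z(2), of x] by (meson mult_right_mono norm_ge_zero order_trans)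
  qed
  moreover have "(\<Sum>z\<in>C. 2 * m z) \<ge> 0" using m(1) by (intro sum_nonneg) (simp add: less_imp_le)
  ultimately show ?thesis using that by blast
qed

text \<open>Resolvent identity: G z - G w = (z - w) G z R G w.\<close>

lemma resolvent_lipschitz_on_disc:
  obtains L where "L \<ge> 0"
    "\<And>z w x. cmod z \<le> b \<Longrightarrow> cmod w \<le> b \<Longrightarrow> norm (G z x - G w x) \<le> L * cmod (z - w) * norm x"
proof -
  obtain K where K: "K > 0" "\<And>x. norm (R x) \<le> norm x * K"
    using bounded_linear.pos_bounded[OF R_lin] by blast
  obtain M where M: "M \<ge> 0" "\<And>z x. cmod z \<le> b \<Longrightarrow> norm (G z x) \<le> M * norm x"
    using resolvent_bounded_on_disc by blast
  have "norm (G z x - G w x) \<le> (M * (M * K)) * cmod (z - w) * norm x"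
    if "cmod z \<le> b" "cmod w \<le> b" for z w x
  proof -
    let ?y = "G w x"
    have "G z x - ?y = G z (?y - w *\<^sub>C R ?y) - G z (?y - z *\<^sub>C R ?y)"
      using G_right[of w x] G_left[of z ?y] by simp
    also have "\<dots> = G z ((z - w) *\<^sub>C R ?y)"
      using G_lin[of z] by (simp add: linear_simps cvs.scale_left_diff_distrib)
    also have "norm \<dots> \<le> M * (cmod (z - w) * norm (R ?y))"
      using M(2)[OF that(1)] by (metis norm_scaleC)
    also have "\<dots> \<le> M * (cmod (z - w) * (norm ?y * K))"
      using M(1) K(2) by (intro mult_left_mono) auto
    also have "\<dots> \<le> M * (cmod (z - w) * ((M * norm x) * K))"
      using M(1) K(1) M(2)[OF that(2)] by (intro mult_left_mono mult_right_mono) auto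
    finally show ?thesis by (simp add: mult_ac)
  qed
  moreover have "M * (M * K) \<ge> 0" using M K by simp
  ultimately show ?thesis using that by blast
qed

text \<open>Convergence of \<rho>^N R^N to 0 in operator norm: the threshold for N is uniform in
  \<open>x\<close>.\<close>

definition powers_vanish :: "real \<Rightarrow> bool" where
  "powers_vanish \<rho> \<longleftrightarrow>
    (\<forall>e>0. \<forall>\<^sub>F N in sequentially. \<forall>x. \<rho> ^ N * norm ((R ^^ N) x) \<le> e * norm x)"

text \<open>For large N the mean at radius \<rho> is within 1/4 of the identity, and by the
  Lipschitz bound the mean at \<sigma> = \<rho> + 2\<epsilon> is within 1/4 of it. Hence the mean at
  \<sigma>, a left inverse of I - \<sigma>^N R^N, is bounded below by 1/2, and \<sigma>^N R^N is
  bounded by 3. Retreating to \<rho> + \<epsilon> turns boundedness into geometric decay.\<close>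

lemma powers_vanish_step:
  assumes M: "M \<ge> 0" "\<And>z x. cmod z \<le> b \<Longrightarrow> norm (G z x) \<le> M * norm x"
    and L: "L \<ge> 0" "\<And>z w x. cmod z \<le> b \<Longrightarrow> cmod w \<le> b \<Longrightarrow>
      norm (G z x - G w x) \<le> L * cmod (z - w) * norm x"
    and \<rho>: "0 \<le> \<rho>" "\<rho> + 2 * \<epsilon> \<le> b" "\<epsilon> > 0" "L * (2 * \<epsilon>) \<le> 1 / 4"
    and van: "powers_vanish \<rho>"
  shows "powers_vanish (\<rho> + \<epsilon>)"
  unfolding powers_vanish_def
proof (intro allI impI)
  fix e :: real assume e: "e > 0"
  define \<sigma> where "\<sigma> = \<rho> + 2 * \<epsilon>"
  have \<sigma>: "\<sigma> > 0" "\<sigma> \<le> b" "0 \<le> \<sigma>" "\<bar>\<sigma> - \<rho>\<bar> = 2 * \<epsilon>" using \<rho> by (auto simp: \<sigma>_def)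
  define q where "q = (\<rho> + \<epsilon>) / \<sigma>"
  have q: "0 \<le> q" "q < 1" using \<rho> \<sigma> by (auto simp: q_def \<sigma>_def field_simps)
  have "\<forall>\<^sub>F N in sequentially. \<forall>x. \<rho> ^ N * norm ((R ^^ N) x) \<le> 1 / (4 * (M + 1)) * norm x"
    using van[unfolded powers_vanish_def, rule_format, of "1 / (4 * (M + 1))"] M(1) by simp
  moreover have "\<forall>\<^sub>F N in sequentially. q ^ N < e / 3"
    using LIMSEQ_realpow_zero[OF q] e by (intro order_tendstoD(2)) auto
  moreover have "\<forall>\<^sub>F N in sequentially. N > 0" by (rule eventually_gt_at_top)
  ultimately show "\<forall>\<^sub>F N in sequentially. \<forall>x. (\<rho> + \<epsilon>) ^ N * norm ((R ^^ N) x) \<le> e * norm x"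
  proof eventually_elim
    case (elim N)
    show ?case
    proof
      fix x
      let ?w = "\<lambda>k. cis (2 * pi * real k / real N)"
      have mean_le: "norm (circle_mean N \<rho> y) \<le> M * norm y" for y
      proof -
        have "norm (\<Sum>k<N. G (of_real \<rho> * ?w k) y) \<le> (\<Sum>k<N. M * norm y)"
          using \<rho> by (intro sum_norm_le M(2)) (simp add: norm_mult)
        then show ?thesis using elim(3) by (simp add: circle_mean_def field_simps)
      qed
      have mean_diff: "norm (circle_mean N \<sigma> y - circle_mean N \<rho> y) \<le> norm y / 4" for y
      proof -
        have "norm (G (of_real \<sigma> * ?w k) y - G (of_real \<rho> * ?w k) y) \<le> norm y / 4" for k
        proof -
          have "norm (G (of_real \<sigma> * ?w k) y - G (of_real \<rho> * ?w k) y)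
              \<le> L * cmod (of_real \<sigma> * ?w k - of_real \<rho> * ?w k) * norm y"
            using \<rho> \<sigma> by (intro L(2)) (simp_all add: norm_mult)
          also have "cmod (of_real \<sigma> * ?w k - of_real \<rho> * ?w k) = 2 * \<epsilon>"
            using \<sigma>(4) by (simp add: left_diff_distrib[symmetric] norm_mult flip: of_real_diff)
          also have "L * (2 * \<epsilon>) * norm y \<le> 1 / 4 * norm y"
            using \<rho>(4) by (intro mult_right_mono) auto
          finally show ?thesis by simp
        qed
        then have "norm (\<Sum>k<N. G (of_real \<sigma> * ?w k) y - G (of_real \<rho> * ?w k) y) \<le> (\<Sum>k<N. norm y / 4)"
          by (intro sum_norm_le)
        then have "norm ((1 / real N) *\<^sub>R (\<Sum>k<N. G (of_real \<sigma> * ?w k) y - G (of_real \<rho> * ?w k) y)) \<le> norm y / 4"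
          using elim(3) by (simp add: field_simps)
        then show ?thesis
          by (simp add: circle_mean_def sum_subtractf scaleR_diff_right)
      qed
      have mean_near: "norm (circle_mean N \<rho> y - y) \<le> norm y / 4" for y
      proof -
        have lin: "linear (circle_mean N \<rho>)"
          unfolding circle_mean_def using G_lin
          by (intro linearI) (simp_all add: linear_simps sum.distrib scaleR_add_right scaleR_sum_right mult.commute)
        have "circle_mean N \<rho> y - y = circle_mean N \<rho> (y - (y - \<rho> ^ N *\<^sub>R (R ^^ N) y))"
          using circle_mean_left_inverse[OF elim(3), of \<rho> y] by (simp only: linear_diff[OF lin])
        also have "norm \<dots> \<le> M * (\<rho> ^ N * norm ((R ^^ N) y))"
          using mean_le[of "\<rho> ^ N *\<^sub>R (R ^^ N) y"] \<rho>(1) by simp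
        also have "\<dots> \<le> M * (1 / (4 * (M + 1)) * norm y)"
          using elim(1) M(1) by (intro mult_left_mono) auto
        also have "\<dots> = (M / (M + 1)) * (norm y / 4)"
          using M(1) by (simp add: field_simps)
        also have "\<dots> \<le> 1 * (norm y / 4)"
          using M(1) by (intro mult_right_mono) (auto simp: field_simps)
        finally show ?thesis by simp
      qed
      have expand: "norm y \<le> 2 * norm (circle_mean N \<sigma> y)" for y
      proof -
        have "norm y \<le> norm (circle_mean N \<sigma> y) + norm (circle_mean N \<sigma> y - y)"
          by (metis norm_triangle_sub norm_minus_commute)
        moreover have "norm (circle_mean N \<sigma> y - y) \<le> norm y / 4 + norm y / 4"
          using norm_triangle_ineq[of "circle_mean N \<sigma> y - circle_mean N \<rho> y" "circle_mean N \<rho> y - y"]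
            mean_diff[of y] mean_near[of y] by simp
        ultimately show ?thesis by simp
      qed
      define a where "a = norm ((R ^^ N) x)"
      \<comment> \<open>The mean at \<sigma> of this vector is \<open>x\<close>, so the lower bound
        for the mean becomes an upper bound for the vector.\<close>
      have "norm (x - \<sigma> ^ N *\<^sub>R (R ^^ N) x) \<le> 2 * norm x"
        using expand[of "x - \<sigma> ^ N *\<^sub>R (R ^^ N) x"] by (simp only: circle_mean_left_inverse[OF elim(3)])
      then have "norm (\<sigma> ^ N *\<^sub>R (R ^^ N) x) \<le> 3 * norm x"
        using norm_triangle_ineq4[of x "x - \<sigma> ^ N *\<^sub>R (R ^^ N) x"] by simp
      then have a: "\<sigma> ^ N * a \<le> 3 * norm x" using \<sigma> by (simp add: a_def)
      have "(\<rho> + \<epsilon>) ^ N * a = q ^ N * (\<sigma> ^ N * a)"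
        using \<sigma>(1) by (simp add: q_def power_divide)
      also have "\<dots> \<le> q ^ N * (3 * norm x)"
        using a q by (intro mult_left_mono) auto
      also have "\<dots> \<le> (e / 3) * (3 * norm x)"
        using elim(2) by (intro mult_right_mono) auto
      finally show "(\<rho> + \<epsilon>) ^ N * norm ((R ^^ N) x) \<le> e * norm x" by (simp add: a_def)
    qed
  qed
qed

text \<open>M and L are taken once, on the disc of radius b + 2, so a single step size works
  throughout and finitely many steps lead from 0 to b.\<close>

lemma all_powers_vanish:
  assumes b: "b \<ge> 0"
  shows "powers_vanish b"
proof -
  obtain M where M: "M \<ge> 0" "\<And>z x. cmod z \<le> b + 2 \<Longrightarrow> norm (G z x) \<le> M * norm x"
    using resolvent_bounded_on_disc by blast
  obtain L where L: "L \<ge> 0" "\<And>z w x. cmod z \<le> b + 2 \<Longrightarrow> cmod w \<le> b + 2 \<Longrightarrow>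
      norm (G z x - G w x) \<le> L * cmod (z - w) * norm x"
    using resolvent_lipschitz_on_disc by blast
  have zero: "powers_vanish 0"
    unfolding powers_vanish_def
  proof (intro allI impI)
    fix e :: real assume e: "e > 0"
    have "\<forall>\<^sub>F N in sequentially. N > (0::nat)" by (rule eventually_gt_at_top)
    then show "\<forall>\<^sub>F N in sequentially. \<forall>x. 0 ^ N * norm ((R ^^ N) x) \<le> e * norm x"
      by eventually_elim (use e in \<open>simp add: power_0_left\<close>)
  qed
  show ?thesis
  proof (cases "b = 0")
    case False
    \<comment> \<open>n \<ge> b gives \<epsilon> \<le> 1, which keeps every overshoot within radius
      b + 2; n \<ge> 8Lb gives 2L\<epsilon> \<le> 1/4.\<close>
    define n where "n = Suc (nat \<lceil>b + 8 * L * b\<rceil>)"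
    have n: "real n \<ge> b" "real n \<ge> 8 * L * b" "real n > 0"
      using b L(1) mult_nonneg_nonneg[of "8 * L" b] unfolding n_def by linarith+
    define \<epsilon> where "\<epsilon> = b / real n"
    have \<epsilon>: "\<epsilon> > 0" "\<epsilon> \<le> 1" "L * (2 * \<epsilon>) \<le> 1 / 4"
      using n b False by (auto simp: \<epsilon>_def field_simps)
    have "powers_vanish (real k * \<epsilon>)" if "k \<le> n" for k
      using that
    proof (induction k)
      case (Suc k)
      have "real k * \<epsilon> \<le> real n * \<epsilon>" using Suc.prems \<epsilon> by (intro mult_right_mono) auto
      also have "real n * \<epsilon> = b" using n by (simp add: \<epsilon>_def)
      finally have "real k * \<epsilon> + 2 * \<epsilon> \<le> b + 2" using \<epsilon>(2) by simp
      from powers_vanish_step[OF M L _ this \<epsilon>(1,3)] Suc \<epsilon>(1)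
      have "powers_vanish (real k * \<epsilon> + \<epsilon>)" by simp
      then show ?case by (simp add: algebra_simps)
    qed (simp add: zero)
    from this[of n] show ?thesis using n by (simp add: \<epsilon>_def)
  qed (simp add: zero)
qed

lemma quasinilpotent:
  assumes q: "q > 0"
  obtains C where "C \<ge> 0" "\<And>n x. norm ((R ^^ n) x) \<le> C * q ^ n * norm x"
proof -
  obtain K where K: "K > 0" "\<And>x. norm (R x) \<le> norm x * K"
    using bounded_linear.pos_bounded[OF R_lin] by blast
  have pow: "norm ((R ^^ n) x) \<le> K ^ n * norm x" for n x
  proof (induction n)
    case (Suc n)
    have "norm ((R ^^ Suc n) x) \<le> norm ((R ^^ n) x) * K" using K(2) by simp
    also have "\<dots> \<le> (K ^ n * norm x) * K" using Suc K(1) by (intro mult_right_mono) auto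
    finally show ?case by (simp add: mult_ac)
  qed simp
  have "\<forall>\<^sub>F N in sequentially. \<forall>x. (1 / q) ^ N * norm ((R ^^ N) x) \<le> 1 * norm x"
    using all_powers_vanish[of "1 / q", unfolded powers_vanish_def, rule_format, of 1] q by simp
  then obtain N0 where N0: "\<And>N x. N \<ge> N0 \<Longrightarrow> (1 / q) ^ N * norm ((R ^^ N) x) \<le> norm x"
    unfolding eventually_sequentially by auto
  \<comment> \<open>The sum pays for the finitely many powers below \<open>N0\<close>, the summand 1
    for the rest.\<close>
  define C where "C = 1 + (\<Sum>n<N0. (K / q) ^ n)"
  have C1: "C \<ge> 1" using K q by (auto simp: C_def intro!: sum_nonneg)
  have "norm ((R ^^ n) x) \<le> C * q ^ n * norm x" for n x
  proof (cases "n < N0")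
    case True
    have "(K / q) ^ n \<le> (\<Sum>n<N0. (K / q) ^ n)"
      using True K q by (intro member_le_sum) auto
    then have "(K / q) ^ n \<le> C" by (simp add: C_def)
    then have "K ^ n \<le> C * q ^ n" using q by (simp add: power_divide field_simps)
    then show ?thesis
      using pow[of n x] by (meson mult_right_mono norm_ge_zero order_trans)
  next
    case False
    then have "norm ((R ^^ n) x) \<le> 1 * (q ^ n * norm x)"
      using N0[of n x] q by (simp add: power_divide field_simps)
    also have "\<dots> \<le> C * (q ^ n * norm x)" using C1 q by (intro mult_right_mono) auto
    finally show ?thesis by (simp add: mult_ac)
  qed
  then show ?thesis using that[of C] C1 by simp
qed

end

section \<open>Strong continuity\<close>

text \<open>By Baire some \<open>C m\<close> contains a ball around a point a. Writing y as the
  difference of the points a + y and a of this ball bounds all \<open>f n\<close> on a small ball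
  around 0.\<close>

lemma Banach_Steinhaus_sequence:
  fixes f :: "nat \<Rightarrow> 'a::banach \<Rightarrow> 'b::real_normed_vector"
  assumes lin: "\<And>n. bounded_linear (f n)"
    and bdd: "\<And>x. bounded (range (\<lambda>n. f n x))"
  obtains M where "M \<ge> 0" "\<And>n x. norm (f n x) \<le> M * norm x"
proof -
  define C where "C m = {x. \<forall>n. norm (f n x) \<le> real m}" for m :: nat
  have cont: "continuous_on UNIV (f n)" for n
    using linear_continuous_on[OF lin] .
  have "closed (C m)" for m
  proof -
    have "C m = (\<Inter>n. {x. norm (f n x) \<le> real m})" by (auto simp: C_def)
    moreover have "closed {x. norm (f n x) \<le> real m}" for n
      by (intro closed_Collect_le continuous_intros cont)
    ultimately show ?thesis by auto
  qed
  moreover have "(\<Union>m. C m) = UNIV"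
  proof -
    have "\<exists>m. x \<in> C m" for x
    proof -
      obtain B where B: "\<And>n. norm (f n x) \<le> B" using bdd[of x] by (auto simp: bounded_iff)
      obtain m where "B \<le> real m" using real_arch_simple by blast
      then have "x \<in> C m" using B by (auto simp: C_def intro: order_trans)
      then show ?thesis ..
    qed
    then show ?thesis by auto
  qed
  moreover have "Met_TC.mcomplete TYPE('a)"
    unfolding Met_TC.mcomplete_def by (auto simp: Cauchy_convergent_iff convergent_def)
  ultimately have "\<exists>m. interior (C m) \<noteq> {}"
    using Met_TC.metric_Baire_category_alt[where 'a='a, of "range C"] by fastforce
  then obtain m a where "a \<in> interior (C m)" by blast
  then obtain r where r: "r > 0" "cball a r \<subseteq> C m"
    using mem_interior_cball by blast
  have "norm (f n x) \<le> (2 * real m / r) * norm x" for n x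
  proof (cases "x = 0")
    case True
    then show ?thesis using lin by (simp add: linear_simps)
  next
    case False
    define y where "y = (r / norm x) *\<^sub>R x"
    have ny: "norm y = r" using False r by (simp add: y_def)
    have "a + y \<in> C m" "a \<in> C m" using r ny by (auto simp: dist_norm subset_iff)
    then have "norm (f n (a + y)) \<le> m" "norm (f n a) \<le> m" by (auto simp: C_def)
    moreover have "f n y = f n (a + y) - f n a" using lin by (simp add: linear_simps)
    ultimately have "norm (f n y) \<le> 2 * real m"
      using norm_triangle_ineq4[of "f n (a + y)" "f n a"] by simp
    moreover have "f n y = (r / norm x) *\<^sub>R f n x"
      using lin by (simp add: y_def linear_simps)
    ultimately show ?thesis using False r by (simp add: field_simps)
  qed
  moreover have "2 * real m / r \<ge> 0" using r by simp
  ultimately show ?thesis using that by blast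
qed

context
  fixes T :: "real \<Rightarrow> 'a::complex_banach \<Rightarrow> 'a"
  assumes sg: "C0_semigroup T"
begin

lemma semigroup_bounded_linear: "t \<ge> 0 \<Longrightarrow> bounded_linear (T t)"
  using sg by (simp add: C0_semigroup_def bounded_clinear_def)

lemma semigroup_clinear: "t \<ge> 0 \<Longrightarrow> T t (c *\<^sub>C x) = c *\<^sub>C T t x"
  using sg by (simp add: C0_semigroup_def bounded_clinear_def Vector_Spaces.linear_iff)

lemma semigroup_0: "T 0 x = x"
  using sg by (simp add: C0_semigroup_def)

lemma semigroup_add: "s \<ge> 0 \<Longrightarrow> t \<ge> 0 \<Longrightarrow> T (s + t) x = T s (T t x)"
  using sg by (simp add: C0_semigroup_def)

lemma semigroup_tendsto_0: "((\<lambda>t. T t x) \<longlongrightarrow> x) (at_right 0)"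
  using sg by (simp add: C0_semigroup_def)

text \<open>Operator norms blowing up near 0 would do so along times tending to 0, where strong
  convergence keeps each orbit bounded, against Banach-Steinhaus.\<close>

lemma semigroup_locally_bounded:
  obtains M \<delta> where "M \<ge> 0" "\<delta> > 0" "\<And>t x. 0 \<le> t \<Longrightarrow> t \<le> \<delta> \<Longrightarrow> norm (T t x) \<le> M * norm x"
proof (rule ccontr)
  assume no: "\<not> thesis"
  \<comment> \<open>The times must be positive to converge within \<open>at_right 0\<close>; t = 0
    is harmless, as \<open>T 0\<close> is the identity.\<close>
  have "\<exists>t x. 0 < t \<and> t \<le> inverse (real (Suc n)) \<and> norm (T t x) > real (Suc n) * norm x" for n
  proof (rule ccontr)
    assume H: "\<not> ?thesis"
    have "norm (T t x) \<le> real (Suc n) * norm x" if "0 \<le> t" "t \<le> inverse (real (Suc n))" for t x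
    proof (cases "t = 0")
      case True
      then show ?thesis by (simp add: semigroup_0 distrib_right)
    next
      case False
      then show ?thesis using H that by (meson not_le order_le_less)
    qed
    then show False using no that[of "real (Suc n)" "inverse (real (Suc n))"] by auto
  qed
  then obtain t y where t: "\<And>n. 0 < t n" "\<And>n. t n \<le> inverse (real (Suc n))"
    and y: "\<And>n. norm (T (t n) (y n)) > real (Suc n) * norm (y n)" by metis
  have "t \<longlonglongrightarrow> 0"
    by (rule tendsto_sandwich[OF _ _ tendsto_const LIMSEQ_inverse_real_of_nat])
      (use t in \<open>auto intro!: always_eventually less_imp_le\<close>)
  then have flt: "filterlim t (at_right 0) sequentially"
    using t by (auto simp: filterlim_at less_imp_neq[THEN not_sym])
  have "bounded (range (\<lambda>n. T (t n) x))" for x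
    using convergent_imp_bounded[OF filterlim_compose[OF semigroup_tendsto_0 flt]] by simp
  then obtain M where M: "M \<ge> 0" "\<And>n x. norm (T (t n) x) \<le> M * norm x"
    using Banach_Steinhaus_sequence[of "\<lambda>n. T (t n)"] semigroup_bounded_linear t(1)
    by (metis less_imp_le)
  obtain n where "M \<le> real n" using real_arch_simple by blast
  then have "M * norm (y n) \<le> real (Suc n) * norm (y n)" by (intro mult_right_mono) auto
  with M(2)[of n "y n"] y[of n] show False by simp
qed

lemma semigroup_bounded_on:
  obtains M where "M \<ge> 0" "\<And>t x. 0 \<le> t \<Longrightarrow> t \<le> b \<Longrightarrow> norm (T t x) \<le> M * norm x"
proof -
  obtain M \<delta> where M: "M \<ge> 0" "\<delta> > 0"
      "\<And>t x. 0 \<le> t \<Longrightarrow> t \<le> \<delta> \<Longrightarrow> norm (T t x) \<le> M * norm x"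
    using semigroup_locally_bounded by blast
  have "\<exists>K\<ge>0. \<forall>t x. 0 \<le> t \<longrightarrow> t \<le> real n * \<delta> \<longrightarrow> norm (T t x) \<le> K * norm x" for n
  proof (induction n)
    case 0
    show ?case by (intro exI[of _ 1]) (auto simp: semigroup_0 dest: antisym)
  next
    case (Suc n)
    then obtain K where K: "K \<ge> 0"
      "\<And>t x. 0 \<le> t \<Longrightarrow> t \<le> real n * \<delta> \<Longrightarrow> norm (T t x) \<le> K * norm x" by blast
    have "norm (T t x) \<le> max M (K * M) * norm x" if t: "0 \<le> t" "t \<le> real (Suc n) * \<delta>" for t x
    proof (cases "t \<le> \<delta>")
      case True
      then show ?thesis using M(3)[of t x] t
        by (smt (verit, best) max.cobounded1 mult_right_mono norm_ge_zero)
    next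
      case False
      have "T t x = T (t - \<delta>) (T \<delta> x)"
        using semigroup_add[of "t - \<delta>" \<delta> x] False M(2) by simp
      also have "norm \<dots> \<le> K * norm (T \<delta> x)"
        using K(2)[of "t - \<delta>"] False t by (simp add: algebra_simps)
      also have "\<dots> \<le> K * (M * norm x)"
        using M K by (intro mult_left_mono) auto
      also have "\<dots> \<le> max M (K * M) * norm x"
        by (simp add: mult.assoc[symmetric] mult_right_mono)
      finally show ?thesis .
    qed
    then show ?case using M(1) by (intro exI[of _ "max M (K * M)"]) auto
  qed
  moreover obtain n where "b / \<delta> \<le> real n" using real_arch_simple by blast
  then have "b \<le> real n * \<delta>" using M(2) by (simp add: field_simps)
  ultimately show ?thesis using that by (metis order_trans)
qed

text \<open>Both one-sided limits reduce to T (a + h) x - T a x = T a (T h x - x). For left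
  continuity the base point a moves, hence the bound uniform on [0, s + 1].\<close>

lemma semigroup_continuous_on: "continuous_on {0..} (\<lambda>t. T t x)"
proof -
  have *: "\<exists>d>0. \<forall>t. 0 \<le> t \<longrightarrow> \<bar>t - s\<bar> < d \<longrightarrow> norm (T t x - T s x) < e" if s: "0 \<le> s" and e: "e > 0" for s e
  proof -
    obtain M where M: "M \<ge> 0" "\<And>t x. 0 \<le> t \<Longrightarrow> t \<le> s + 1 \<Longrightarrow> norm (T t x) \<le> M * norm x"
      using semigroup_bounded_on by blast
    have e': "e / (M + 1) > 0" using M e by simp
    obtain d where d: "d > 0" "\<And>h. 0 < h \<Longrightarrow> h < d \<Longrightarrow> norm (T h x - x) < e / (M + 1)"
      using tendstoD[OF semigroup_tendsto_0 e', of x]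
      unfolding eventually_at_right_field dist_norm by auto
    have key: "norm (T (a + h) x - T a x) < e" if "0 \<le> a" "a \<le> s + 1" "0 \<le> h" "h < d" for a h
    proof -
      have "T (a + h) x - T a x = T a (T h x - x)"
        using semigroup_bounded_linear[OF that(1)] semigroup_add[OF that(1,3)]
        by (simp add: linear_simps)
      also have "norm \<dots> \<le> M * norm (T h x - x)" using M(2) that by blast
      also have "norm (T h x - x) \<le> e / (M + 1)"
        using d(2)[of h] that e' by (cases "h = 0") (auto simp: semigroup_0 less_imp_le)
      then have "M * norm (T h x - x) \<le> M * (e / (M + 1))"
        using M by (intro mult_left_mono)
      also have "\<dots> < e" using M(1) e by (simp add: field_simps)
      finally show ?thesis .
    qed
    show ?thesis
    proof (intro exI[of _ "min d 1"] conjI allI impI)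
      fix t assume t: "0 \<le> t" "\<bar>t - s\<bar> < min d 1"
      show "norm (T t x - T s x) < e"
      proof (cases "s \<le> t")
        case True
        then show ?thesis using key[of s "t - s"] t s by simp
      next
        case False
        then show ?thesis using key[of t "s - t"] t s by (simp add: norm_minus_commute)
      qed
    qed (use d in auto)
  qed
  show ?thesis
    unfolding continuous_on_iff using * by (auto simp: dist_norm Ball_def)
qed

lemma semigroup_continuous_on_Icc: "0 \<le> a \<Longrightarrow> continuous_on {a..b} (\<lambda>t. T t x)"
  by (rule continuous_on_subset[OF semigroup_continuous_on]) auto

end

section \<open>Semigroups whose generator has empty spectrum\<close>

lemma integral_right_derivative:
  fixes f :: "real \<Rightarrow> 'b::banach"
  assumes "continuous_on {s..s+1} f"
  shows "((\<lambda>h. (1 / h) *\<^sub>R integral {s..s+h} f) \<longlongrightarrow> f s) (at_right 0)"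
proof -
  have "((\<lambda>u. integral {s..u} f) has_derivative (\<lambda>h. h *\<^sub>R f s)) (at_right s)"
    using integral_has_vector_derivative[OF assms, of s] at_within_Icc_at_right[of s "s + 1"]
    by (simp add: has_vector_derivative_def)
  then have "((\<lambda>y. norm (integral {s..y} f - (y - s) *\<^sub>R f s) / norm (y - s)) \<longlongrightarrow> 0) (at_right s)"
    by (simp add: has_derivative_iff_norm)
  then have lim: "((\<lambda>h. norm (integral {s..s+h} f - h *\<^sub>R f s) / norm h) \<longlongrightarrow> 0) (at_right 0)"
    using filterlim_at_right_to_0[of "\<lambda>y. norm (integral {s..y} f - (y - s) *\<^sub>R f s) / norm (y - s)"
        "nhds 0" s]
    by (simp add: add.commute)
  have "\<forall>\<^sub>F h in at_right 0. norm (integral {s..s+h} f - h *\<^sub>R f s) / norm h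
      = norm ((1 / h) *\<^sub>R integral {s..s+h} f - f s)"
  proof (rule eventually_at_rightI[of 0 1])
    fix h :: real assume h: "h \<in> {0<..<1}"
    have "(1 / h) *\<^sub>R integral {s..s+h} f - f s = (1 / h) *\<^sub>R (integral {s..s+h} f - h *\<^sub>R f s)"
      using h by (simp add: scaleR_diff_right)
    then show "norm (integral {s..s+h} f - h *\<^sub>R f s) / norm h = norm ((1 / h) *\<^sub>R integral {s..s+h} f - f s)"
      using h by simp
  qed simp
  from tendsto_cong[OF this] lim show ?thesis
    by (simp add: tendsto_norm_zero_iff LIM_zero_iff)
qed

context
  fixes T :: "real \<Rightarrow> 'a::complex_banach \<Rightarrow> 'a"
  assumes sg: "C0_semigroup T"
begin

private abbreviation (input) "D \<equiv> generator_domain T"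
private abbreviation (input) "A \<equiv> generator T"

lemma semigroup_integrable: "0 \<le> a \<Longrightarrow> (\<lambda>t. T t x) integrable_on {a..b}"
  by (rule integrable_continuous_real[OF semigroup_continuous_on_Icc[OF sg]])

lemma generatorI:
  assumes "((\<lambda>h. (1 / h) *\<^sub>R (T h x - x)) \<longlongrightarrow> y) (at_right 0)"
  shows "x \<in> D" "A x = y"
  using assms tendsto_Lim[OF trivial_limit_at_right_real assms]
  by (auto simp: generator_domain_def generator_def)

lemma generator_tendsto:
  assumes "x \<in> D"
  shows "((\<lambda>h. (1 / h) *\<^sub>R (T h x - x)) \<longlongrightarrow> A x) (at_right 0)"
  using assms generatorI(2) by (auto simp: generator_domain_def)

lemma semigroup_integral:
  assumes "0 \<le> h" "0 \<le> a"
  shows "T h (integral {a..b} (\<lambda>t. T t x)) = integral {a+h..b+h} (\<lambda>t. T t x)"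
proof -
  have "T h (integral {a..b} (\<lambda>t. T t x)) = integral {a..b} (\<lambda>t. T h (T t x))"
    using integral_linear[OF semigroup_integrable[OF assms(2), where x=x and b=b]
        semigroup_bounded_linear[OF sg assms(1)]]
    by (simp add: o_def)
  also have "\<dots> = integral {a..b} (\<lambda>t. T (t + h) x)"
    using assms by (intro integral_cong) (simp add: semigroup_add[OF sg, symmetric] add.commute)
  also have "\<dots> = integral {a+h..b+h} (\<lambda>t. T t x)"
    using integral_shift_real_ivl[of "a + h" h "b + h" "\<lambda>t. T t x"] by simp
  finally show ?thesis .
qed

text \<open>\<open>T h\<close> shifts the window of integration; the overlap cancels in T h B - B,
  and two end windows of length h remain.\<close>

lemma integral_semigroup_generator:
  fixes x :: 'a
  assumes \<tau>: "\<tau> \<ge> 0"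
  defines "B \<equiv> integral {0..\<tau>} (\<lambda>t. T t x)"
  shows "B \<in> D" "A B = T \<tau> x - x"
proof -
  let ?f = "\<lambda>t. T t x"
  have cont: "continuous_on {s..s+1} ?f" if "s \<ge> 0" for s
    using semigroup_continuous_on_Icc[OF sg that] .
  have "((\<lambda>h. (1 / h) *\<^sub>R integral {\<tau>..\<tau>+h} ?f - (1 / h) *\<^sub>R integral {0..0+h} ?f) \<longlongrightarrow> T \<tau> x - T 0 x)
      (at_right 0)"
    using \<tau> by (intro tendsto_diff integral_right_derivative cont) auto
  moreover have "\<forall>\<^sub>F h in at_right 0. (1 / h) *\<^sub>R integral {\<tau>..\<tau>+h} ?f - (1 / h) *\<^sub>R integral {0..0+h} ?f
      = (1 / h) *\<^sub>R (T h B - B)"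
  proof (rule eventually_at_rightI[of 0 1])
    fix h :: real assume h: "h \<in> {0<..<1}"
    have "integral {0..h} ?f + integral {h..\<tau>+h} ?f = integral {0..\<tau>+h} ?f"
      "integral {0..\<tau>} ?f + integral {\<tau>..\<tau>+h} ?f = integral {0..\<tau>+h} ?f"
      using h \<tau> by (auto intro!: Henstock_Kurzweil_Integration.integral_combine semigroup_integrable)
    moreover have "T h B = integral {h..\<tau>+h} ?f"
      using semigroup_integral[where h=h and a=0 and b=\<tau> and x=x] h by (simp add: B_def)
    ultimately have "T h B - B = integral {\<tau>..\<tau>+h} ?f - integral {0..h} ?f"
      by (simp add: B_def algebra_simps)
    then show "(1 / h) *\<^sub>R integral {\<tau>..\<tau>+h} ?f - (1 / h) *\<^sub>R integral {0..0+h} ?f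
      = (1 / h) *\<^sub>R (T h B - B)" by (simp add: scaleR_diff_right)
  qed simp
  ultimately have "((\<lambda>h. (1 / h) *\<^sub>R (T h B - B)) \<longlongrightarrow> T \<tau> x - x) (at_right 0)"
    by (simp add: tendsto_cong semigroup_0[OF sg])
  then show "B \<in> D" "A B = T \<tau> x - x" by (rule generatorI)+
qed

lemma generator_commute:
  assumes x: "x \<in> D" and t: "t \<ge> 0"
  shows "T t x \<in> D" "A (T t x) = T t (A x)"
proof -
  have lim: "((\<lambda>h. T t ((1 / h) *\<^sub>R (T h x - x))) \<longlongrightarrow> T t (A x)) (at_right 0)"
    using bounded_linear.tendsto[OF semigroup_bounded_linear[OF sg t] generator_tendsto[OF x]] .
  have "\<forall>\<^sub>F h in at_right 0. T t ((1 / h) *\<^sub>R (T h x - x)) = (1 / h) *\<^sub>R (T h (T t x) - T t x)"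
  proof (rule eventually_at_rightI[of 0 1])
    fix h :: real assume h: "h \<in> {0<..<1}"
    then have "T t (T h x) = T h (T t x)"
      using semigroup_add[OF sg, of h t x] semigroup_add[OF sg, of t h x] t by (simp add: add.commute)
    then show "T t ((1 / h) *\<^sub>R (T h x - x)) = (1 / h) *\<^sub>R (T h (T t x) - T t x)"
      using semigroup_bounded_linear[OF sg t] by (simp add: linear_simps)
  qed simp
  with lim have "((\<lambda>h. (1 / h) *\<^sub>R (T h (T t x) - T t x)) \<longlongrightarrow> T t (A x)) (at_right 0)"
    by (simp add: tendsto_cong)
  then show "T t x \<in> D" "A (T t x) = T t (A x)" by (rule generatorI)+
qed

section \<open>Consequences of the empty spectrum\<close>

context
  assumes empty: "spectrum D A = {}"
begin

definition resolvent :: "complex \<Rightarrow> 'a \<Rightarrow> 'a" where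
  "resolvent \<mu> = inv_into D (\<lambda>x. \<mu> *\<^sub>C x - A x)"

lemma resolvent_bij: "bij_betw (\<lambda>x. \<mu> *\<^sub>C x - A x) D UNIV"
  and resolvent_bounded_clinear: "bounded_clinear (resolvent \<mu>)"
  using empty by (auto simp: spectrum_def resolvent_set_def resolvent_def)

lemma resolvent_right: "resolvent \<mu> y \<in> D" "\<mu> *\<^sub>C resolvent \<mu> y - A (resolvent \<mu> y) = y"
proof -
  have y: "y \<in> (\<lambda>x. \<mu> *\<^sub>C x - A x) ` D" using resolvent_bij[of \<mu>] by (simp add: bij_betw_def)
  show "resolvent \<mu> y \<in> D" unfolding resolvent_def using y by (rule inv_into_into)
  show "\<mu> *\<^sub>C resolvent \<mu> y - A (resolvent \<mu> y) = y"
    unfolding resolvent_def using f_inv_into_f[OF y] .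
qed

lemma resolvent_eqI: "x \<in> D \<Longrightarrow> \<mu> *\<^sub>C x - A x = y \<Longrightarrow> resolvent \<mu> y = x"
  unfolding resolvent_def using bij_betw_imp_inj_on[OF resolvent_bij[of \<mu>]]
  by (blast intro: inv_into_f_eq)

lemma resolvent_commute:
  assumes t: "t \<ge> 0"
  shows "resolvent \<mu> (T t x) = T t (resolvent \<mu> x)"
proof (rule resolvent_eqI)
  let ?y = "resolvent \<mu> x"
  show "T t ?y \<in> D" using generator_commute[OF resolvent_right(1) t] by simp
  have "\<mu> *\<^sub>C T t ?y - A (T t ?y) = T t (\<mu> *\<^sub>C ?y - A ?y)"
    using semigroup_bounded_linear[OF sg t] generator_commute[OF resolvent_right(1) t]
    by (simp add: linear_simps semigroup_clinear[OF sg t])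
  then show "\<mu> *\<^sub>C T t ?y - A (T t ?y) = T t x" by (simp add: resolvent_right)
qed

text \<open>The source of the factor R in S: the integral solves -A y = x - T \<tau> x.\<close>

lemma integral_semigroup_resolvent:
  assumes "\<tau> \<ge> 0"
  shows "integral {0..\<tau>} (\<lambda>t. T t x) = resolvent 0 (x - T \<tau> x)"
  using integral_semigroup_generator[OF assms, of x]
  by (intro resolvent_eqI[symmetric]) simp_all

text \<open>For R = (0 - A)^(-1) one has I - zR = (-z - A) R. Its inverse -A (-z - A)^(-1) equals I
  + z (-z - A)^(-1), a form that is visibly bounded.\<close>

lemma resolvent_0_quasinilpotent:
  assumes "q > 0"
  obtains C where "C \<ge> 0" "\<And>n x. norm ((resolvent 0 ^^ n) x) \<le> C * q ^ n * norm x"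
proof (rule quasinilpotent[where R = "resolvent 0" and G = "\<lambda>z x. x + z *\<^sub>C resolvent (- z) x" and q = q])
  let ?R = "resolvent 0" and ?G = "\<lambda>z x. x + z *\<^sub>C resolvent (- z) x"
  show "bounded_clinear ?R" by (rule resolvent_bounded_clinear)
  fix z x
  note lin = resolvent_bounded_clinear[of "- z"]
  show "bounded_clinear (?G z)"
    unfolding bounded_clinear_def
  proof
    show "Vector_Spaces.linear scaleC scaleC (?G z)"
      using lin unfolding bounded_clinear_def Vector_Spaces.linear_iff
      by (simp add: scaleC_add_right scaleC_scaleC mult.commute)
    have "bounded_linear (\<lambda>y :: 'a. z *\<^sub>C y)"
    proof (rule bounded_linear_intro[where K = "cmod z"])
      show "z *\<^sub>C (r *\<^sub>R y) = r *\<^sub>R (z *\<^sub>C y)" for r and y :: 'a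
        by (simp add: scaleC_of_real[symmetric] scaleC_scaleC mult.commute)
    qed (simp_all add: scaleC_add_right norm_scaleC mult.commute)
    from bounded_linear_add[OF bounded_linear_ident
        bounded_linear_compose[OF this bounded_clinear_bounded_linear[OF lin]]]
    show "bounded_linear (?G z)" .
  qed
  show "?G z (x - z *\<^sub>C ?R x) = x"
  proof -
    have "resolvent (- z) (x - z *\<^sub>C ?R x) = ?R x"
      using resolvent_right[of 0 x] by (intro resolvent_eqI) (simp_all add: algebra_simps)
    then show ?thesis by simp
  qed
  show "?G z x - z *\<^sub>C ?R (?G z x) = x"
  proof -
    let ?y = "resolvent (- z) x"
    have "0 *\<^sub>C ?y - A ?y = ((- z) *\<^sub>C ?y - A ?y) + z *\<^sub>C ?y" by simp
    then have "0 *\<^sub>C ?y - A ?y = x + z *\<^sub>C ?y" by (simp only: resolvent_right)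
    with resolvent_right(1) have "?R (?G z x) = ?y" by (rule resolvent_eqI)
    then show ?thesis by simp
  qed
qed (use assms that in auto)

text \<open>S = R L with \<open>L\<close> bounded and commuting with R, hence S^n = R^n L^n.\<close>

lemma averaged_semigroup_quasinilpotent:
  fixes x :: 'a
  assumes s: "s \<ge> 0" and \<tau>: "\<tau> \<ge> 0" and q: "q > 0"
  obtains C where "C \<ge> 0"
    "\<And>n. norm (((\<lambda>x. T s (integral {0..\<tau>} (\<lambda>t. T t x))) ^^ n) x) \<le> C * q ^ n"
proof -
  let ?R = "resolvent 0"
  define L where "L x = T s (x - T \<tau> x)" for x
  note R_lin = bounded_clinear_bounded_linear[OF resolvent_bounded_clinear[of 0]]
  have L_lin: "bounded_linear L"
    unfolding L_def
    by (intro bounded_linear_compose[OF semigroup_bounded_linear[OF sg s]]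
        bounded_linear_sub bounded_linear_ident semigroup_bounded_linear[OF sg \<tau>])
  have S: "T s (integral {0..\<tau>} (\<lambda>t. T t x)) = ?R (L x)" for x
    by (simp add: integral_semigroup_resolvent[OF \<tau>] L_def resolvent_commute[OF s])
  have LR: "L (?R x) = ?R (L x)" for x
    using R_lin by (simp add: L_def linear_simps resolvent_commute s \<tau>)
  have LRn: "L ((?R ^^ n) x) = (?R ^^ n) (L x)" for n x
    by (induction n) (simp_all add: LR)
  have Sn: "((\<lambda>x. ?R (L x)) ^^ n) x = (?R ^^ n) ((L ^^ n) x)" for n
  proof (induction n)
    case (Suc n)
    then show ?case by (simp add: LRn)
  qed simp
  obtain K where K: "K > 0" "\<And>x. norm (L x) \<le> norm x * K"
    using bounded_linear.pos_bounded[OF L_lin] by blast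
  have Ln: "norm ((L ^^ n) x) \<le> K ^ n * norm x" for n
  proof (induction n)
    case (Suc n)
    have "norm ((L ^^ Suc n) x) \<le> norm ((L ^^ n) x) * K" using K(2) by simp
    also have "\<dots> \<le> (K ^ n * norm x) * K" using Suc K(1) by (intro mult_right_mono) auto
    finally show ?case by (simp add: mult_ac)
  qed simp
  \<comment> \<open>The rate q / K compensates in advance for the growth \<open>K ^ n\<close> of the
    powers of \<open>L\<close>.\<close>
  obtain C where C: "C \<ge> 0" "\<And>n x. norm ((?R ^^ n) x) \<le> C * (q / K) ^ n * norm x"
    using resolvent_0_quasinilpotent[of "q / K"] q K(1) by auto
  have "norm (((\<lambda>x. ?R (L x)) ^^ n) x) \<le> (C * norm x) * q ^ n" for n
  proof -
    have "norm (((\<lambda>x. ?R (L x)) ^^ n) x) \<le> C * (q / K) ^ n * norm ((L ^^ n) x)"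
      unfolding Sn by (rule C(2))
    also have "\<dots> \<le> C * (q / K) ^ n * (K ^ n * norm x)"
      using C(1) q K(1) by (intro mult_left_mono Ln) auto
    also have "\<dots> = (C * norm x) * q ^ n" using K(1) by (simp add: power_divide)
    finally show ?thesis .
  qed
  then show ?thesis using that[of "C * norm x"] C(1) unfolding S by simp
qed

end

end

section \<open>Irreducible eventually positive semigroups on real Banach lattices\<close>

lemma abs_scaleR_le: "\<bar>c *\<^sub>R x\<bar> \<le> \<bar>c\<bar> *\<^sub>R \<bar>x :: 'a::banach_lattice\<bar>"
proof (rule abs_leI)
  show "- (c *\<^sub>R x) \<le> \<bar>c\<bar> *\<^sub>R \<bar>x\<bar>" using scaleR_le_abs[of "- c" x] by simp
qed (rule scaleR_le_abs)

lemma banach_lattice_archimedean: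
  fixes x y :: "'a::banach_lattice"
  assumes "0 \<le> x" "\<And>n::nat. real n *\<^sub>R x \<le> y"
  shows "x = 0"
proof (rule ccontr)
  assume "x \<noteq> 0"
  then obtain n where n: "norm y < real n * norm x"
    using reals_Archimedean3[of "norm x"] by auto
  have "norm (real n *\<^sub>R x) \<le> norm y"
    using assms by (intro norm_mono_nonneg) (simp_all add: scaleR_nonneg_nonneg)
  with n show False by simp
qed

lemma closed_ge_banach_lattice: "closed {x :: 'a::banach_lattice. a \<le> x}"
  unfolding closed_sequential_limits
proof clarify
  fix X and l :: 'a
  assume X: "\<forall>n. X n \<in> {x. a \<le> x}" "X \<longlonglongrightarrow> l"
  show "a \<le> l" by (rule LIMSEQ_le_banach_lattice[OF tendsto_const X(2)]) (use X(1) in blast)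
qed

lemma closed_le_banach_lattice: "closed {x :: 'a::banach_lattice. x \<le> a}"
  unfolding closed_sequential_limits
proof clarify
  fix X and l :: 'a
  assume X: "\<forall>n. X n \<in> {x. x \<le> a}" "X \<longlonglongrightarrow> l"
  show "l \<le> a" by (rule LIMSEQ_le_banach_lattice[OF X(2) tendsto_const]) (use X(1) in blast)
qed

text \<open>The Riemann sums of tagged divisions lie in the positive cone, which is closed.\<close>

lemma integral_nonneg_banach_lattice:
  fixes f :: "real \<Rightarrow> 'a::banach_lattice"
  assumes f: "f integrable_on {a..b}" and pos: "\<And>t. a \<le> t \<Longrightarrow> t \<le> b \<Longrightarrow> 0 \<le> f t"
  shows "0 \<le> integral {a..b} f"
proof -
  let ?I = "integral {a..b} f"
  have approx: "\<exists>S\<ge>0. norm (S - ?I) < e" if "e > 0" for e :: real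
  proof -
    from integrable_integral[OF f, unfolded has_integral_real, rule_format, OF that]
    obtain \<gamma> where "gauge \<gamma> \<and> (\<forall>D. D tagged_division_of {a..b} \<and> \<gamma> fine D \<longrightarrow>
        norm ((\<Sum>(x,k)\<in>D. measure lborel k *\<^sub>R f x) - ?I) < e)"
      by (rule exE)
    note \<gamma> = conjunct1[OF this] conjunct2[OF this, rule_format, OF conjI]
    obtain D where D: "D tagged_division_of {a..b}" "\<gamma> fine D"
      using fine_division_exists_real[OF \<gamma>(1)] .
    have "0 \<le> (\<Sum>(x,k)\<in>D. measure lborel k *\<^sub>R f x)"
    proof (rule sum_nonneg, clarify)
      fix x k assume "(x, k) \<in> D"
      then have "x \<in> {a..b}" by (rule tag_in_interval[OF D(1)])
      then have "0 \<le> f x" by (intro pos) simp_all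
      then show "0 \<le> measure lborel k *\<^sub>R f x" by (rule scaleR_nonneg_nonneg[OF measure_nonneg])
    qed
    with \<gamma>(2)[OF D] show ?thesis by (intro exI conjI)
  qed
  have "\<exists>S\<ge>0. norm (S - ?I) < inverse (real (Suc n))" for n
    by (rule approx) simp
  then obtain S where S: "\<And>n. 0 \<le> S n" "\<And>n. norm (S n - ?I) < inverse (real (Suc n))" by metis
  have "(\<lambda>n. S n - ?I) \<longlonglongrightarrow> 0"
    using S(2) by (intro Lim_null_comparison[OF _ LIMSEQ_inverse_real_of_nat] always_eventually)
      (simp add: less_imp_le)
  then have "S \<longlonglongrightarrow> ?I" by (simp add: LIM_zero_iff)
  then show ?thesis using S(1) by (rule LIMSEQ_nonneg)
qed

section \<open>Ideals of the real lattice\<close>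

definition real_ideal :: "'a::banach_lattice set \<Rightarrow> bool" where
  "real_ideal J \<longleftrightarrow> subspace J \<and> (\<forall>x\<in>J. \<forall>y. \<bar>y\<bar> \<le> \<bar>x\<bar> \<longrightarrow> y \<in> J)"

lemma real_ideal_closure:
  assumes J: "real_ideal J"
  shows "real_ideal (closure J)"
  unfolding real_ideal_def
proof (intro conjI ballI allI impI)
  have sub: "subspace J" using J by (simp add: real_ideal_def)
  show "subspace (closure J)"
  proof (rule subspaceI)
    show "0 \<in> closure J" using subspace_0[OF sub] closure_subset by blast
  next
    fix x y assume "x \<in> closure J" "y \<in> closure J"
    then obtain X Y where "\<And>n. X n \<in> J" "X \<longlonglongrightarrow> x" "\<And>n. Y n \<in> J" "Y \<longlonglongrightarrow> y"
      unfolding closure_sequential by blast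
    then have "\<And>n. X n + Y n \<in> J" "(\<lambda>n. X n + Y n) \<longlonglongrightarrow> x + y"
      by (auto intro: subspace_add[OF sub] tendsto_add)
    then show "x + y \<in> closure J" unfolding closure_sequential by (intro exI[of _ "\<lambda>n. X n + Y n"]) auto
  next
    fix c x assume "x \<in> closure J"
    then obtain X where "\<And>n. X n \<in> J" "X \<longlonglongrightarrow> x" unfolding closure_sequential by blast
    then have "\<And>n. c *\<^sub>R X n \<in> J" "(\<lambda>n. c *\<^sub>R X n) \<longlonglongrightarrow> c *\<^sub>R x"
      by (auto intro: subspace_scale[OF sub] intro!: tendsto_intros)
    then show "c *\<^sub>R x \<in> closure J" unfolding closure_sequential by (intro exI[of _ "\<lambda>n. c *\<^sub>R X n"]) auto
  qed
next
  fix x y assume "x \<in> closure J" and yx: "\<bar>y\<bar> \<le> \<bar>x\<bar>"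
  then obtain X where X: "\<And>n. X n \<in> J" "X \<longlonglongrightarrow> x" unfolding closure_sequential by blast
  \<comment> \<open>Clip y to the order interval from -|X n| to |X n|. As |y| \<le> |x| \<le> |X n|
    + |X n - x|, this moves y by at most |X n - x|.\<close>
  define Y where "Y n = sup (inf y \<bar>X n\<bar>) (- \<bar>X n\<bar>)" for n
  have "Y n \<in> J" for n
  proof -
    have "- \<bar>X n\<bar> \<le> \<bar>X n\<bar>" by (meson abs_ge_zero neg_le_0_iff_le order_trans)
    then have "Y n \<le> \<bar>X n\<bar>" unfolding Y_def by simp
    moreover have "- Y n \<le> \<bar>X n\<bar>" unfolding Y_def by (metis minus_le_iff sup.cobounded2)
    ultimately have "\<bar>Y n\<bar> \<le> \<bar>X n\<bar>" by (rule abs_leI)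
    then show ?thesis using J X(1) by (auto simp: real_ideal_def)
  qed
  moreover have "Y \<longlonglongrightarrow> y"
  proof -
    have "norm (Y n - y) \<le> norm (X n - x)" for n
    proof -
      let ?d = "\<bar>X n - x\<bar>"
      have tri: "\<bar>x\<bar> \<le> \<bar>X n\<bar> + ?d"
        using abs_triangle_ineq[of "X n" "x - X n"] by (simp add: abs_minus_commute)
      have "y \<le> \<bar>X n\<bar> + ?d" "- y \<le> \<bar>X n\<bar> + ?d"
        using yx tri by (meson abs_ge_self abs_ge_minus_self order_trans)+
      then have "y - ?d \<le> \<bar>X n\<bar>" "- (\<bar>X n\<bar> + ?d) \<le> y"
        by (simp_all only: diff_le_eq minus_le_iff)
      then have le: "y - ?d \<le> \<bar>X n\<bar>" "- \<bar>X n\<bar> \<le> y + ?d"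
        using diff_le_eq[of "- \<bar>X n\<bar>" ?d y] by simp_all
      have "y - ?d \<le> inf y \<bar>X n\<bar>" using le(1) by simp
      then have "y - ?d \<le> Y n" unfolding Y_def by (rule le_supI1)
      then have "- (Y n - y) \<le> ?d" by (simp add: algebra_simps)
      moreover have "Y n \<le> y + ?d"
        unfolding Y_def using le(2) by (intro sup_least) (auto intro: le_infI1)
      then have "Y n - y \<le> ?d" by (simp add: algebra_simps)
      ultimately show ?thesis by (intro norm_mono_abs abs_leI)
    qed
    moreover have "(\<lambda>n. norm (X n - x)) \<longlonglongrightarrow> 0"
      using X(2) by (simp add: LIM_zero tendsto_norm_zero)
    ultimately have "(\<lambda>n. Y n - y) \<longlonglongrightarrow> 0"
      by (metis (no_types, lifting) Lim_null_comparison always_eventually)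
    then show ?thesis by (simp add: LIM_zero_iff)
  qed
  ultimately show "y \<in> closure J" unfolding closure_sequential by blast
qed

text \<open>For nonnegative increasing \<open>f\<close> this is the ideal generated by all values f
  \<tau> with \<tau> \<ge> 0; a constant \<open>f\<close> gives a principal ideal.\<close>

definition dominated_by :: "(real \<Rightarrow> 'a::banach_lattice) \<Rightarrow> 'a set" where
  "dominated_by f = {g. \<exists>\<tau>\<ge>0. \<exists>c\<ge>0. \<bar>g\<bar> \<le> c *\<^sub>R f \<tau>}"

lemma real_ideal_dominated_by:
  assumes pos: "\<And>\<tau>. \<tau> \<ge> 0 \<Longrightarrow> 0 \<le> f \<tau>" and mono: "\<And>\<sigma> \<tau>. 0 \<le> \<sigma> \<Longrightarrow> \<sigma> \<le> \<tau> \<Longrightarrow> f \<sigma> \<le> f \<tau>"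
  shows "real_ideal (dominated_by f)"
  unfolding real_ideal_def
proof (intro conjI ballI allI impI)
  show "subspace (dominated_by f)"
  proof (rule subspaceI)
    show "0 \<in> dominated_by f"
      unfolding dominated_by_def by (auto intro!: exI[of _ "0::real"])
  next
    fix x y assume "x \<in> dominated_by f" "y \<in> dominated_by f"
    then obtain a c b d where *: "a \<ge> 0" "c \<ge> 0" "\<bar>x\<bar> \<le> c *\<^sub>R f a" "b \<ge> 0" "d \<ge> 0" "\<bar>y\<bar> \<le> d *\<^sub>R f b"
      unfolding dominated_by_def by auto
    have "\<bar>x + y\<bar> \<le> \<bar>x\<bar> + \<bar>y\<bar>" by (rule abs_triangle_ineq)
    also have "\<dots> \<le> c *\<^sub>R f a + d *\<^sub>R f b" using * by (intro add_mono)
    also have "\<dots> \<le> c *\<^sub>R f (max a b) + d *\<^sub>R f (max a b)"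
      using * by (intro add_mono scaleR_left_mono mono) auto
    also have "\<dots> = (c + d) *\<^sub>R f (max a b)" by (simp add: scaleR_left_distrib)
    finally show "x + y \<in> dominated_by f"
      unfolding dominated_by_def using *
      by (intro CollectI exI[of _ "max a b"] exI[of _ "c + d"] conjI) auto
  next
    fix r x assume "x \<in> dominated_by f"
    then obtain a c where *: "a \<ge> 0" "c \<ge> 0" "\<bar>x\<bar> \<le> c *\<^sub>R f a"
      unfolding dominated_by_def by auto
    have "\<bar>r *\<^sub>R x\<bar> \<le> \<bar>r\<bar> *\<^sub>R \<bar>x\<bar>" by (rule abs_scaleR_le)
    also have "\<dots> \<le> \<bar>r\<bar> *\<^sub>R (c *\<^sub>R f a)" using * by (intro scaleR_left_mono) auto
    finally show "r *\<^sub>R x \<in> dominated_by f"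
      unfolding dominated_by_def using *
      by (intro CollectI exI[of _ a] exI[of _ "\<bar>r\<bar> * c"] conjI) auto
  qed
next
  fix x y assume "x \<in> dominated_by f" "\<bar>y\<bar> \<le> \<bar>x\<bar>"
  then show "y \<in> dominated_by f" unfolding dominated_by_def by (auto intro: order_trans)
qed

lemma inf_pos_neg_parts: "inf (sup y 0) (sup (- y) 0) = (0 :: 'a::banach_lattice)"
proof -
  have "sup (- y) 0 = sup y 0 + - y"
    unfolding add_sup_distrib_right by (simp add: sup_commute)
  then have "inf (sup y 0) (sup (- y) 0) = inf (sup y 0 + 0) (sup y 0 + - y)"
    by simp
  also have "\<dots> = sup y 0 + inf 0 (- y)"
    by (simp only: add_inf_distrib_left)
  also have "inf 0 (- y) = - sup y 0" by (simp add: neg_sup_eq_inf inf_commute)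
  finally show ?thesis by (simp only: add.right_inverse)
qed

text \<open>If g in the ideal of a approximates b, then the positive part of b - |b - g| lies below
  b and below a multiple of a, so it vanishes by disjointness. Thus b \<le> |b - g|, whose norm is
  too small.\<close>

lemma disjoint_from_dense_ideal:
  fixes a b :: "'a::banach_lattice"
  assumes ab: "0 \<le> a" "0 \<le> b" "inf a b = 0"
    and dense: "closure (dominated_by (\<lambda>_. a)) = UNIV"
  shows "b = 0"
proof (rule ccontr)
  assume "b \<noteq> 0"
  then have "norm b > 0" by simp
  then obtain g where g: "g \<in> dominated_by (\<lambda>_. a)" "dist g b < norm b"
    using dense closure_approachable[of b "dominated_by (\<lambda>_. a)"] by (metis UNIV_I)
  then obtain c where c: "c \<ge> 0" "\<bar>g\<bar> \<le> c *\<^sub>R a" by (auto simp: dominated_by_def)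
  define d where "d = \<bar>b - g\<bar>"
  define m where "m = sup (b - d) 0"
  have d0: "0 \<le> d" by (simp add: d_def)
  have "b \<le> \<bar>b\<bar>" by (rule abs_ge_self)
  also have "\<dots> \<le> d + \<bar>g\<bar>" using abs_triangle_ineq[of "b - g" g] by (simp add: d_def)
  also have "\<dots> \<le> d + (c + 1) *\<^sub>R a" using c ab(1) by (simp add: scaleR_left_distrib add_increasing2)
  finally have "b - d \<le> (c + 1) *\<^sub>R a" by (simp add: algebra_simps)
  then have "m \<le> (c + 1) *\<^sub>R a"
    using ab(1) c by (simp add: m_def scaleR_nonneg_nonneg)
  then have "(1 / (c + 1)) *\<^sub>R m \<le> (1 / (c + 1)) *\<^sub>R ((c + 1) *\<^sub>R a)"
    using c by (intro scaleR_left_mono) auto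
  then have ma: "(1 / (c + 1)) *\<^sub>R m \<le> a" using c by simp
  have "b - d \<le> b" using d0 by simp
  then have "m \<le> b" using ab(2) by (simp add: m_def)
  moreover have "(1 / (c + 1)) *\<^sub>R m \<le> 1 *\<^sub>R m"
    using c by (intro scaleR_right_mono) (auto simp: m_def)
  ultimately have "(1 / (c + 1)) *\<^sub>R m \<le> b" by simp
  with ma have "(1 / (c + 1)) *\<^sub>R m \<le> 0" using ab(3) by (metis inf_greatest)
  then have "(c + 1) *\<^sub>R ((1 / (c + 1)) *\<^sub>R m) \<le> (c + 1) *\<^sub>R 0"
    using c by (intro scaleR_left_mono) auto
  then have "m \<le> 0" using c by simp
  then have "b - d \<le> 0" by (simp add: m_def)
  then have "norm b \<le> norm d" using ab(2) by (intro norm_mono_nonneg) auto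
  also have "norm d = dist g b" by (simp add: d_def norm_abs_eq dist_norm norm_minus_commute)
  finally show False using g(2) by simp
qed

text \<open>The scalars c with c x \<le> y and those with y \<le> c x cover the line by totality.
  Both sets are closed, and nonempty by the Archimedean property, so they meet by
  connectedness.\<close>

lemma total_order_imp_one_dimensional:
  fixes x :: "'a::banach_lattice"
  assumes total: "\<And>y::'a. 0 \<le> y \<or> y \<le> 0" and x: "0 \<le> x" "x \<noteq> 0"
  obtains c where "y = c *\<^sub>R x"
proof -
  let ?A = "{c. c *\<^sub>R x \<le> y}" and ?B = "{c. y \<le> c *\<^sub>R x}"
  have cont: "continuous_on UNIV (\<lambda>c. c *\<^sub>R x)" by (intro continuous_intros)
  have "closed ?A" "closed ?B"
    using continuous_closed_preimage[OF cont closed_UNIV closed_le_banach_lattice[of y]]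
      continuous_closed_preimage[OF cont closed_UNIV closed_ge_banach_lattice[of y]]
    by (simp_all add: vimage_def)
  moreover have AB: "c \<in> ?A \<or> c \<in> ?B" for c
    using total[of "y - c *\<^sub>R x"] by auto
  moreover have "?A \<noteq> {}"
  proof
    assume "?A = {}"
    then have "y \<le> (- real n) *\<^sub>R x" for n using AB by blast
    then have "real n *\<^sub>R x \<le> - y" for n by (metis le_minus_iff scaleR_minus_left)
    then show False using banach_lattice_archimedean[OF x(1)] x(2) by blast
  qed
  moreover have "?B \<noteq> {}"
  proof
    assume "?B = {}"
    then have "real n *\<^sub>R x \<le> y" for n using AB by blast
    then show False using banach_lattice_archimedean[OF x(1)] x(2) by blast
  qed
  moreover have "UNIV \<subseteq> ?A \<union> ?B" using AB by blast
  ultimately have "?A \<inter> ?B \<noteq> {}"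
    using connected_UNIV[where 'a=real, unfolded connected_closed, simplified, rule_format, of ?A ?B]
    by blast
  then show ?thesis using that by (auto intro: antisym)
qed

section \<open>Irreducible eventually positive semigroups: non-vanishing, domination and
  growth\<close>

locale eventually_positive_irreducible =
  fixes P :: "real \<Rightarrow> 'a::banach_lattice \<Rightarrow> 'a" and t\<^sub>1 :: real
  assumes lin: "t \<ge> 0 \<Longrightarrow> bounded_linear (P t)"
    and P_0: "P 0 x = x"
    and P_add: "s \<ge> 0 \<Longrightarrow> t \<ge> 0 \<Longrightarrow> P (s + t) x = P s (P t x)"
    and cont: "continuous_on {0..} (\<lambda>t. P t x)"
    and t1: "t\<^sub>1 \<ge> 0"
    and pos: "t \<ge> t\<^sub>1 \<Longrightarrow> 0 \<le> x \<Longrightarrow> 0 \<le> P t x"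
    and irreducible: "real_ideal J \<Longrightarrow> closed J \<Longrightarrow> s \<ge> 0 \<Longrightarrow>
      (\<And>t x. t \<ge> s \<Longrightarrow> x \<in> J \<Longrightarrow> P t x \<in> J) \<Longrightarrow> J = {0} \<or> J = UNIV"
begin

text \<open>The ideals constructed below need not be closed; boundedness of \<open>P t\<close>
  carries their invariance over to the closure.\<close>

lemma irreducible_dense:
  assumes J: "real_ideal J" and s: "s \<ge> 0" and inv: "\<And>t x. t \<ge> s \<Longrightarrow> x \<in> J \<Longrightarrow> P t x \<in> J"
  shows "J \<subseteq> {0} \<or> closure J = UNIV"
proof -
  have "P t x \<in> closure J" if t: "t \<ge> s" and x: "x \<in> closure J" for t x
  proof -
    have "P t ` J \<subseteq> J" using inv[OF t] by auto
    then have "P t ` closure J \<subseteq> closure J"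
      using closure_bounded_linear_image_subset[OF lin, of t J] t s closure_mono
      by (meson order_trans)
    then show ?thesis using x by blast
  qed
  then have "closure J = {0} \<or> closure J = UNIV"
    using irreducible[OF real_ideal_closure[OF J] closed_closure s] by blast
  then show ?thesis using closure_subset by blast
qed

lemma mono: "t \<ge> t\<^sub>1 \<Longrightarrow> x \<le> y \<Longrightarrow> P t x \<le> P t y"
proof -
  assume *: "t \<ge> t\<^sub>1" "x \<le> y"
  then have "0 \<le> P t (y - x)" by (intro pos) simp_all
  also have "P t (y - x) = P t y - P t x"
    using * t1 by (intro linear_diff bounded_linear.linear lin) simp
  finally show ?thesis by simp
qed

lemma abs_le: "t \<ge> t\<^sub>1 \<Longrightarrow> \<bar>P t x\<bar> \<le> P t \<bar>x\<bar>"
proof (rule abs_leI)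
  assume t: "t \<ge> t\<^sub>1"
  then show "P t x \<le> P t \<bar>x\<bar>" by (rule mono) (rule abs_ge_self)
  have "P t (- x) \<le> P t \<bar>x\<bar>" using t by (rule mono) (rule abs_ge_minus_self)
  also have "P t (- x) = - P t x"
    using t t1 by (intro linear_neg bounded_linear.linear lin) simp
  finally show "- P t x \<le> P t \<bar>x\<bar>" .
qed

lemma integrable: "0 \<le> a \<Longrightarrow> (\<lambda>t. P t x) integrable_on {a..b}"
proof (rule integrable_continuous_real)
  assume "0 \<le> a"
  then show "continuous_on {a..b} (\<lambda>t. P t x)"
    using continuous_on_subset[OF cont, of "{a..b}" x] by auto
qed

lemma P_integral:
  assumes "0 \<le> h" "0 \<le> a"
  shows "P h (integral {a..b} (\<lambda>t. P t x)) = integral {a+h..b+h} (\<lambda>t. P t x)"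
proof -
  have "P h (integral {a..b} (\<lambda>t. P t x)) = integral {a..b} (\<lambda>t. P h (P t x))"
    using integral_linear[OF integrable[OF assms(2), where x=x and b=b] lin[OF assms(1)]]
    by (simp add: o_def)
  also have "\<dots> = integral {a..b} (\<lambda>t. P (t + h) x)"
    using assms by (intro integral_cong) (simp add: P_add[symmetric] add.commute)
  also have "\<dots> = integral {a+h..b+h} (\<lambda>t. P t x)"
    using integral_shift_real_ivl[of "a + h" h "b + h" "\<lambda>t. P t x"] by simp
  finally show ?thesis .
qed

text \<open>Otherwise every closed ideal would be invariant from some time on, so the lattice would be
  one-dimensional and \<open>P\<close> a continuous exponential family, which never vanishes.\<close>

lemma not_nilpotent:
  assumes nonzero: "\<exists>x::'a. x \<noteq> 0" and s: "s \<ge> 0"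
  shows "\<exists>t\<ge>s. \<exists>x. P t x \<noteq> 0"
proof (rule ccontr)
  assume "\<not> ?thesis"
  then have nil: "P t x = 0" if "t \<ge> s" for t x using that by blast
  have dense: "J \<subseteq> {0} \<or> closure J = UNIV" if "real_ideal J" for J :: "'a set"
    using irreducible_dense[OF that s] nil subspace_0 that by (auto simp: real_ideal_def)
  have total: "0 \<le> y \<or> y \<le> 0" for y :: 'a
  proof -
    \<comment> \<open>The ideal of the positive part of y is either zero, and then y \<le> 0, or
      dense, and then the disjoint negative part vanishes.\<close>
    define J where "J = dominated_by (\<lambda>_. sup y 0)"
    have "real_ideal J" unfolding J_def by (rule real_ideal_dominated_by) auto
    from dense[OF this] show ?thesis
    proof
      assume "J \<subseteq> {0}"
      moreover have "sup y 0 \<in> J"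
        unfolding J_def dominated_by_def by (auto intro!: exI[of _ "0::real"] exI[of _ "1::real"])
      ultimately have "sup y 0 = 0" by blast
      then show ?thesis by (metis sup.cobounded1)
    next
      assume "closure J = UNIV"
      then have "sup (- y) 0 = 0"
        using disjoint_from_dense_ideal[of "sup y 0" "sup (- y) 0"] inf_pos_neg_parts[of y]
        by (simp add: J_def)
      then have "- y \<le> 0" by (metis sup.cobounded1)
      then show ?thesis by simp
    qed
  qed
  obtain x0 :: 'a where "x0 \<noteq> 0" using nonzero by blast
  define x where "x = \<bar>x0\<bar>"
  have x: "0 \<le> x" "x \<noteq> 0" using \<open>x0 \<noteq> 0\<close> by (simp_all add: x_def)
  \<comment> \<open>On a line each \<open>P t\<close> is a scalar, and P (s/2^n) is the square of P
    (s/2^(n+1)). So vanishing descends to times tending to 0, against continuity at 0.\<close>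
  have "P (s / 2 ^ n) x = 0" for n
  proof (induction n)
    case (Suc n)
    let ?t = "s / 2 ^ Suc n"
    have t: "?t \<ge> 0" using s by simp
    obtain c where c: "P ?t x = c *\<^sub>R x"
      using total_order_imp_one_dimensional[OF total x] by blast
    have "P (s / 2 ^ n) x = P ?t (P ?t x)"
      using P_add[OF t t, of x] by (simp add: field_simps)
    also have "\<dots> = c *\<^sub>R c *\<^sub>R x" using lin[OF t] c by (simp add: linear_simps)
    finally have "c = 0" using Suc.IH x(2) by simp
    then show ?case using c by simp
  qed (use nil in simp)
  moreover have "(\<lambda>n. P (s / 2 ^ n) x) \<longlonglongrightarrow> P 0 x"
  proof (rule continuous_on_tendsto_compose[OF cont])
    show "(\<lambda>n. s / 2 ^ n) \<longlonglongrightarrow> 0"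
      by (intro tendsto_divide_0[OF tendsto_const] filterlim_at_top_imp_at_infinity
          filterlim_realpow_sequentially_gt1) simp
  qed (use s in auto)
  ultimately have "P 0 x = 0" by (simp add: LIMSEQ_const_iff)
  then show False using x(2) by (simp add: P_0)
qed

text \<open>Boundedness into E_u, drawn from positivity: without a uniform constant, a weighted sum
  \<open>z\<close> of positive counterexamples would dominate each of them, while
  \<open>P t z\<close> lies below a single multiple of u.\<close>

lemma uniform_domination:
  assumes t: "t \<ge> t\<^sub>1" and u: "0 \<le> u" and dom: "\<And>x. \<exists>c. \<bar>P t x\<bar> \<le> c *\<^sub>R u"
  obtains K where "K \<ge> 0" "\<And>x. \<bar>P t x\<bar> \<le> (K * norm x) *\<^sub>R u"
proof (rule ccontr)
  assume no: "\<not> thesis"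
  note Pt = bounded_linear.linear[OF lin[OF order_trans[OF t1 t]]]
  \<comment> \<open>The factor 2^n pays for summability, and the factor n outgrows the constant
    belonging to \<open>z\<close>.\<close>
  have "\<exists>x. \<not> \<bar>P t x\<bar> \<le> (real n * 2 ^ n * norm x) *\<^sub>R u" for n
    using no that[of "real n * 2 ^ n"] by auto
  then obtain x where x: "\<And>n. \<not> \<bar>P t (x n)\<bar> \<le> (real n * 2 ^ n * norm (x n)) *\<^sub>R u" by metis
  have nx: "norm (x n) > 0" for n
  proof (rule ccontr)
    assume "\<not> norm (x n) > 0"
    then have "x n = 0" by simp
    then show False using x[of n] linear_0[OF Pt] by simp
  qed
  define y where "y n = (1 / (2 ^ n * norm (x n))) *\<^sub>R \<bar>x n\<bar>" for n
  have y0: "0 \<le> y n" for n by (simp add: y_def scaleR_nonneg_nonneg)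
  have "norm (y n) = (1 / 2) ^ n" for n
    using nx[of n] by (simp add: y_def norm_abs_eq power_one_over)
  then have "summable (\<lambda>n. norm (y n))" by (simp add: summable_geometric)
  then have sum: "summable y" by (rule summable_norm_cancel)
  define z where "z = suminf y"
  have yz: "y n \<le> z" for n
  proof (rule LIMSEQ_le_banach_lattice[OF tendsto_const])
    show "(\<lambda>k. \<Sum>i<k + Suc n. y i) \<longlonglongrightarrow> z"
      using LIMSEQ_ignore_initial_segment[OF summable_LIMSEQ[OF sum], of "Suc n"] by (simp add: z_def)
    show "y n \<le> (\<Sum>i<k + Suc n. y i)" for k
    proof -
      have "(\<Sum>i<k + Suc n. y i) = y n + sum y ({..<k + Suc n} - {n})"
        by (rule sum.remove) auto
      moreover have "0 \<le> sum y ({..<k + Suc n} - {n})" by (rule sum_nonneg) (rule y0)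
      ultimately show ?thesis by simp
    qed
  qed
  obtain c where c: "\<bar>P t z\<bar> \<le> c *\<^sub>R u" using dom by blast
  obtain n where n: "c \<le> real n" using real_arch_simple by blast
  have "\<bar>P t (x n)\<bar> \<le> P t \<bar>x n\<bar>" by (rule abs_le[OF t])
  also have "\<bar>x n\<bar> = (2 ^ n * norm (x n)) *\<^sub>R y n" using nx[of n] by (simp add: y_def)
  also have "P t \<dots> = (2 ^ n * norm (x n)) *\<^sub>R P t (y n)" by (rule linear_scale[OF Pt])
  also have "\<dots> \<le> (2 ^ n * norm (x n)) *\<^sub>R (real n *\<^sub>R u)"
  proof (rule scaleR_left_mono)
    have "P t (y n) \<le> P t z" by (rule mono[OF t yz])
    also have "\<dots> \<le> c *\<^sub>R u" using c abs_ge_self order_trans by blast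
    also have "\<dots> \<le> real n *\<^sub>R u" using n u by (rule scaleR_right_mono)
    finally show "P t (y n) \<le> real n *\<^sub>R u" .
  qed simp
  finally show False using x[of n] by (simp add: mult_ac)
qed

text \<open>The set J in the proof is an ideal that every \<open>P t\<close> with t \<ge>
  \<open>t\<^sub>1\<close> maps to 0. If it contained u, irreducibility would make it dense, and
  \<open>P\<close> would vanish from \<open>t\<^sub>1\<close> on.\<close>

lemma not_eventually_vanishing:
  assumes nonzero: "\<exists>x::'a. x \<noteq> 0" and u: "0 \<le> u" "u \<noteq> 0"
  obtains r where "r \<ge> t\<^sub>1" "P r u \<noteq> 0"
proof (rule ccontr)
  assume no: "\<not> thesis"
  define J where "J = {g. \<forall>t\<ge>t\<^sub>1. P t \<bar>g\<bar> = 0}"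
  have P0: "P t 0 = 0" if "t \<ge> t\<^sub>1" for t
    using linear_0[OF bounded_linear.linear[OF lin]] that t1 by simp
  have squeeze: "P t \<bar>y\<bar> = 0" if "\<bar>y\<bar> \<le> a" "P t a = 0" "t \<ge> t\<^sub>1" for y a t
  proof (rule antisym)
    show "P t \<bar>y\<bar> \<le> 0" using mono[OF that(3,1)] unfolding that(2) .
    show "0 \<le> P t \<bar>y\<bar>" by (rule pos[OF that(3) abs_ge_zero])
  qed
  have "real_ideal J"
    unfolding real_ideal_def
  proof (intro conjI ballI allI impI subspaceI)
    show "0 \<in> J" by (simp add: J_def P0)
  next
    fix x y assume xy: "x \<in> J" "y \<in> J"
    show "x + y \<in> J"
      unfolding J_def
    proof (intro CollectI allI impI)
      fix t assume t: "t \<ge> t\<^sub>1"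
      have "P t (\<bar>x\<bar> + \<bar>y\<bar>) = P t \<bar>x\<bar> + P t \<bar>y\<bar>"
        using t t1 by (intro linear_add bounded_linear.linear lin) simp
      then have "P t (\<bar>x\<bar> + \<bar>y\<bar>) = 0" using xy t by (simp add: J_def)
      then show "P t \<bar>x + y\<bar> = 0" by (rule squeeze[OF abs_triangle_ineq _ t])
    qed
  next
    fix c x assume x: "x \<in> J"
    show "c *\<^sub>R x \<in> J"
      unfolding J_def
    proof (intro CollectI allI impI)
      fix t assume t: "t \<ge> t\<^sub>1"
      have "P t (\<bar>c\<bar> *\<^sub>R \<bar>x\<bar>) = \<bar>c\<bar> *\<^sub>R P t \<bar>x\<bar>"
        using t t1 by (intro linear_scale bounded_linear.linear lin) simp
      then have "P t (\<bar>c\<bar> *\<^sub>R \<bar>x\<bar>) = 0" using x t by (simp add: J_def)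
      then show "P t \<bar>c *\<^sub>R x\<bar> = 0" by (rule squeeze[OF abs_scaleR_le _ t])
    qed
  next
    fix x y assume "x \<in> J" "\<bar>y\<bar> \<le> \<bar>x\<bar>"
    then show "y \<in> J" unfolding J_def using squeeze by blast
  qed
  moreover have vanish: "P t x = 0" if "t \<ge> t\<^sub>1" "x \<in> J" for t x
  proof -
    have "\<bar>P t x\<bar> \<le> 0" using abs_le[OF that(1), of x] that by (simp add: J_def)
    then show ?thesis by simp
  qed
  moreover have "0 \<in> J" by (simp add: J_def P0)
  ultimately have "J \<subseteq> {0} \<or> closure J = UNIV"
    using irreducible_dense[OF _ t1, of J] by metis
  moreover have "u \<in> J" using no that u(1) unfolding J_def by auto
  ultimately have dense: "closure J = UNIV" using u(2) by blast
  have "P t x = 0" if t: "t \<ge> t\<^sub>1" for t x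
  proof (rule continuous_constant_on_closure[where S = J and f = "P t" and a = 0])
    show "continuous_on (closure J) (P t)"
      using lin[of t] t t1 by (intro linear_continuous_on) simp
    show "x \<in> closure J" using dense by simp
  qed (use vanish t in auto)
  then show False using not_nilpotent[OF nonzero t1] by blast
qed

lemma averaged_growth:
  assumes nonzero: "\<exists>x::'a. x \<noteq> 0" and u: "0 \<le> u" and t0: "t\<^sub>0 \<ge> 0"
    and dom: "\<And>x. \<exists>c. \<bar>P t\<^sub>0 x\<bar> \<le> c *\<^sub>R u"
    and \<delta>: "\<delta> > 0" "\<delta> *\<^sub>R u \<le> P t\<^sub>0 w"
  obtains U s \<tau> c where "0 \<le> U" "U \<noteq> 0" "c > 0" "s \<ge> 0" "\<tau> \<ge> 0"
    "\<And>n. c ^ n *\<^sub>R U \<le> ((\<lambda>x. P s (integral {0..\<tau>} (\<lambda>t. P t x))) ^^ n) U"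
proof -
  \<comment> \<open>The given inequalities live at time \<open>t\<^sub>0\<close>, where positivity
    may fail. The positive operator \<open>P t\<^sub>1\<close> moves them to time \<open>T\<close>,
    with \<open>U\<close> in place of \<open>u\<close>.\<close>
  define U where "U = P t\<^sub>1 u"
  define T where "T = t\<^sub>1 + t\<^sub>0"
  have T: "T \<ge> t\<^sub>1" "T \<ge> 0" using t0 t1 by (auto simp: T_def)
  have U0: "0 \<le> U" using u by (simp add: U_def pos)
  note P1 = bounded_linear.linear[OF lin[OF t1]]
  note PT = bounded_linear.linear[OF lin[OF T(2)]]
  have PTx: "P T x = P t\<^sub>1 (P t\<^sub>0 x)" for x unfolding T_def by (rule P_add[OF t1 t0])
  have domU: "\<exists>c. \<bar>P T x\<bar> \<le> c *\<^sub>R U" for x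
  proof -
    obtain c where c: "\<bar>P t\<^sub>0 x\<bar> \<le> c *\<^sub>R u" using dom by blast
    have "\<bar>P T x\<bar> \<le> P t\<^sub>1 \<bar>P t\<^sub>0 x\<bar>" unfolding PTx by (rule abs_le) simp
    also have "\<dots> \<le> P t\<^sub>1 (c *\<^sub>R u)" by (rule mono[OF _ c]) simp
    also have "\<dots> = c *\<^sub>R U" unfolding U_def by (rule linear_scale[OF P1])
    finally show ?thesis by blast
  qed
  have wU: "\<delta> *\<^sub>R U \<le> P T w"
  proof -
    have "\<delta> *\<^sub>R U = P t\<^sub>1 (\<delta> *\<^sub>R u)" unfolding U_def by (rule linear_scale[OF P1, symmetric])
    also have "\<dots> \<le> P T w" unfolding PTx by (rule mono[OF _ \<delta>(2)]) simp
    finally show ?thesis .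
  qed
  \<comment> \<open>A multiple of \<open>U\<close> dominates every value of \<open>P T\<close>, so U
    = 0 would make \<open>P\<close> vanish from time \<open>T\<close> on.\<close>
  have U: "U \<noteq> 0"
  proof
    assume "U = 0"
    then have 0: "P T x = 0" for x using domU[of x] by simp
    have "P t x = 0" if "t \<ge> T" for t x
    proof -
      have "P t x = P (t - T) (P T x)" using P_add[of "t - T" T x] that T(2) by simp
      then show ?thesis using linear_0[OF bounded_linear.linear[OF lin, of "t - T"]] that by (simp add: 0)
    qed
    then show False using not_nilpotent[OF nonzero T(2)] by blast
  qed
  obtain K where K: "K \<ge> 0" "\<And>x. \<bar>P T x\<bar> \<le> (K * norm x) *\<^sub>R U"
    using uniform_domination[OF T(1) U0 domU] by blast
  obtain r where r: "r \<ge> t\<^sub>1" "P r U \<noteq> 0"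
    using not_eventually_vanishing[OF nonzero U0 U] by blast
  \<comment> \<open>Starting at \<open>t\<^sub>1\<close> makes the integrand positive, so
    \<open>f\<close> is increasing and each element of its ideal lies below a multiple of one value
    of \<open>f\<close>.\<close>
  define f where "f \<tau> = integral {t\<^sub>1..t\<^sub>1 + \<tau>} (\<lambda>t. P t U)" for \<tau>
  have f_split: "f b - f a = integral {t\<^sub>1 + a..t\<^sub>1 + b} (\<lambda>t. P t U)" if "0 \<le> a" "a \<le> b" for a b
    using Henstock_Kurzweil_Integration.integral_combine[of t\<^sub>1 "t\<^sub>1 + a" "t\<^sub>1 + b" "\<lambda>t. P t U"] that
      integrable[OF t1] by (simp add: f_def algebra_simps)
  have int_pos: "0 \<le> integral {a..b} (\<lambda>t. P t U)" if "a \<ge> t\<^sub>1" for a b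
    using that t1 by (intro integral_nonneg_banach_lattice integrable pos U0) auto
  have f_pos: "0 \<le> f \<tau>" for \<tau> unfolding f_def by (rule int_pos) simp
  have f_mono: "f a \<le> f b" if "0 \<le> a" "a \<le> b" for a b
  proof -
    have "0 \<le> f b - f a" unfolding f_split[OF that] by (rule int_pos) (use that in simp)
    then show ?thesis by simp
  qed
  define J where "J = dominated_by f"
  have f_J: "f \<tau> \<in> J" if "\<tau> \<ge> 0" for \<tau>
    unfolding J_def dominated_by_def using that f_pos[of \<tau>]
    by (intro CollectI exI[of _ \<tau>] exI[of _ 1] conjI) (simp_all add: abs_of_nonneg)
  have "J \<subseteq> {0} \<or> closure J = UNIV"
  proof (rule irreducible_dense[OF _ t1])
    show "real_ideal J" unfolding J_def by (rule real_ideal_dominated_by) (auto intro: f_pos f_mono)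
    fix t x assume t: "t \<ge> t\<^sub>1" and "x \<in> J"
    then obtain a c where ac: "a \<ge> 0" "c \<ge> 0" "\<bar>x\<bar> \<le> c *\<^sub>R f a"
      unfolding J_def dominated_by_def by blast
    have t': "t \<ge> 0" using t t1 by simp
    have "\<bar>P t x\<bar> \<le> P t \<bar>x\<bar>" by (rule abs_le[OF t])
    also have "\<dots> \<le> P t (c *\<^sub>R f a)" by (rule mono[OF t ac(3)])
    also have "\<dots> = c *\<^sub>R P t (f a)" by (rule linear_scale[OF bounded_linear.linear[OF lin[OF t']]])
    \<comment> \<open>Shifting the window by t cuts off its beginning; dropping the positive term
      \<open>f t\<close> gives invariance.\<close>
    also have "P t (f a) = f (a + t) - f t"
      unfolding f_def P_integral[OF t' t1]
      using f_split[of t "a + t"] ac(1) t' by (simp add: f_def add.assoc)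
    also have "c *\<^sub>R \<dots> \<le> c *\<^sub>R f (a + t)"
      using ac(2) f_pos by (intro scaleR_left_mono) simp_all
    finally show "P t x \<in> J"
      unfolding J_def dominated_by_def using ac t'
      by (intro CollectI exI[of _ "a + t"] exI[of _ c] conjI) simp_all
  qed
  \<comment> \<open>If every f \<tau> vanished, so would \<open>P r U\<close>, the right derivative
    of the integral at r.\<close>
  moreover have "\<not> J \<subseteq> {0}"
  proof
    assume "J \<subseteq> {0}"
    then have f0: "f \<tau> = 0" if "\<tau> \<ge> 0" for \<tau> using f_J that by blast
    have cont': "continuous_on {r..r+1} (\<lambda>t. P t U)"
      using r t1 by (intro continuous_on_subset[OF cont]) simp
    have "\<forall>\<^sub>F h in at_right 0. (1 / h) *\<^sub>R integral {r..r+h} (\<lambda>t. P t U) = 0"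
    proof (rule eventually_at_rightI[of 0 1])
      fix h :: real assume "h \<in> {0<..<1}"
      then have "integral {r..r+h} (\<lambda>t. P t U) = f (r - t\<^sub>1 + h) - f (r - t\<^sub>1)"
        using f_split[of "r - t\<^sub>1" "r - t\<^sub>1 + h"] r(1) by (simp add: add.assoc[symmetric])
      then show "(1 / h) *\<^sub>R integral {r..r+h} (\<lambda>t. P t U) = 0"
        using f0 r(1) \<open>h \<in> {0<..<1}\<close> by simp
    qed simp
    then have "((\<lambda>h. (1 / h) *\<^sub>R integral {r..r+h} (\<lambda>t. P t U)) \<longlongrightarrow> 0) (at_right 0)"
      by (rule tendsto_eventually)
    from tendsto_unique[OF trivial_limit_at_right_real integral_right_derivative[OF cont'] this]
    show False using r(2) by simp
  qed
  ultimately have dense: "closure J = UNIV" by blast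
  \<comment> \<open>Replacing \<open>w\<close> by its approximant costs at most K e U under
    \<open>P T\<close>, which is to stay below half of \<delta> U; K + 1 allows K = 0.\<close>
  define e where "e = \<delta> / (2 * (K + 1))"
  have e: "e > 0" "K * e \<le> \<delta> / 2" using \<delta>(1) K(1) by (auto simp: e_def field_simps)
  obtain g where g: "g \<in> J" "dist g w < e"
    using dense closure_approachable[of w J] e(1) by (metis UNIV_I)
  obtain \<tau> c0 where \<tau>: "\<tau> \<ge> 0" "c0 \<ge> 0" "\<bar>g\<bar> \<le> c0 *\<^sub>R f \<tau>"
    using g(1) unfolding J_def dominated_by_def by blast
  define c1 where "c1 = c0 + 1"
  have c1: "c1 > 0" using \<tau>(2) by (simp add: c1_def)
  have g_le: "g \<le> c1 *\<^sub>R f \<tau>"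
    using order_trans[OF abs_ge_self \<tau>(3)] f_pos[of \<tau>]
    by (simp add: c1_def scaleR_left_distrib add_increasing2)
  have "(\<delta> / 2) *\<^sub>R U \<le> P T g"
  proof -
    have "P T w - P T g = P T (w - g)" by (rule linear_diff[OF PT, symmetric])
    also have "\<dots> \<le> (K * norm (w - g)) *\<^sub>R U" using K(2)[of "w - g"] abs_ge_self order_trans by blast
    also have "\<dots> \<le> (\<delta> / 2) *\<^sub>R U"
    proof (rule scaleR_right_mono[OF _ U0])
      have "K * norm (w - g) \<le> K * e"
        using g(2) K(1) by (intro mult_left_mono) (auto simp: dist_norm norm_minus_commute)
      then show "K * norm (w - g) \<le> \<delta> / 2" using e(2) by simp
    qed
    finally have "P T w \<le> (\<delta> / 2) *\<^sub>R U + P T g" by (simp add: algebra_simps)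
    with wU have "\<delta> *\<^sub>R U \<le> (\<delta> / 2) *\<^sub>R U + P T g" by (rule order_trans)
    moreover have "\<delta> *\<^sub>R U = (\<delta> / 2) *\<^sub>R U + (\<delta> / 2) *\<^sub>R U" by (simp flip: scaleR_left_distrib)
    ultimately show ?thesis by simp
  qed
  also have "P T g \<le> P T (c1 *\<^sub>R f \<tau>)" by (rule mono[OF T(1) g_le])
  also have "\<dots> = c1 *\<^sub>R P T (f \<tau>)" by (rule linear_scale[OF PT])
  finally have "(1 / c1) *\<^sub>R ((\<delta> / 2) *\<^sub>R U) \<le> (1 / c1) *\<^sub>R (c1 *\<^sub>R P T (f \<tau>))"
    using c1 by (intro scaleR_left_mono) simp_all
  then have growth: "(\<delta> / (2 * c1)) *\<^sub>R U \<le> P T (f \<tau>)"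
    using c1 by (simp add: mult.commute)
  define c where "c = \<delta> / (2 * c1)"
  have c: "c > 0" using \<delta>(1) c1 by (simp add: c_def)
  \<comment> \<open>\<open>P T\<close> of the window starting at \<open>t\<^sub>1\<close> is
    \<open>P s\<close> of the window starting at 0. The first form shows positivity, the second
    contains the factor R.\<close>
  define s where "s = T + t\<^sub>1"
  have s: "s \<ge> 0" "s \<ge> t\<^sub>1" using T t1 by (auto simp: s_def)
  define S where "S x = P s (integral {0..\<tau>} (\<lambda>t. P t x))" for x
  note Ps = bounded_linear.linear[OF lin[OF s(1)]]
  have S_shift: "S x = P T (integral {t\<^sub>1..t\<^sub>1 + \<tau>} (\<lambda>t. P t x))" for x
    unfolding S_def s_def using P_add[OF T(2) t1] P_integral[OF t1, of 0 \<tau> x] by (simp add: add.commute)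
  have S_pos: "0 \<le> S x" if "0 \<le> x" for x
    unfolding S_shift
    by (intro pos[OF T(1)] integral_nonneg_banach_lattice integrable t1 pos that) simp
  have int_diff: "integral {0..\<tau>} (\<lambda>t. P t (y - x)) = integral {0..\<tau>} (\<lambda>t. P t y) - integral {0..\<tau>} (\<lambda>t. P t x)" for x y
  proof -
    have "integral {0..\<tau>} (\<lambda>t. P t (y - x)) = integral {0..\<tau>} (\<lambda>t. P t y - P t x)"
      by (intro integral_cong linear_diff bounded_linear.linear lin) simp
    then show ?thesis by (simp add: integral_diff integrable)
  qed
  have int_scale: "integral {0..\<tau>} (\<lambda>t. P t (k *\<^sub>R x)) = k *\<^sub>R integral {0..\<tau>} (\<lambda>t. P t x)" for k x
  proof -
    have "integral {0..\<tau>} (\<lambda>t. P t (k *\<^sub>R x)) = integral {0..\<tau>} (\<lambda>t. k *\<^sub>R P t x)"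
      by (intro integral_cong linear_scale bounded_linear.linear lin) simp
    then show ?thesis by simp
  qed
  have S_diff: "S (y - x) = S y - S x" for x y
    unfolding S_def int_diff by (rule linear_diff[OF Ps])
  have S_scale: "S (k *\<^sub>R x) = k *\<^sub>R S x" for k x
    unfolding S_def int_scale by (rule linear_scale[OF Ps])
  have SU: "c *\<^sub>R U \<le> S U" using growth unfolding S_shift f_def c_def .
  have "c ^ n *\<^sub>R U \<le> (S ^^ n) U" for n
  proof (induction n)
    case (Suc n)
    have "c ^ Suc n *\<^sub>R U = c ^ n *\<^sub>R (c *\<^sub>R U)" by (simp add: mult.commute)
    also have "\<dots> \<le> c ^ n *\<^sub>R S U" using SU c by (intro scaleR_left_mono) simp_all
    also have "\<dots> = S (c ^ n *\<^sub>R U)" by (rule S_scale[symmetric])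
    also have "\<dots> \<le> S ((S ^^ n) U)"
      using S_pos[of "(S ^^ n) U - c ^ n *\<^sub>R U"] Suc.IH by (simp add: S_diff)
    finally show ?case by simp
  qed simp
  then show ?thesis using that[OF U0 U c s(1) \<tau>(1)] unfolding S_def by blast
qed

end

section \<open>Complexification\<close>

lemma Cplx_re_im: "z = Cplx (re z) 0 + \<i> *\<^sub>C Cplx (im z) (0 :: 'a::banach_lattice)"
  by (simp add: complexification_eq_iff)

lemma bounded_linear_re: "bounded_linear (re :: 'a::banach_lattice complexification \<Rightarrow> 'a)"
  by (rule bounded_linear_intro[where K = 1]) (simp_all add: norm_re_im_le)

lemma bounded_linear_im: "bounded_linear (im :: 'a::banach_lattice complexification \<Rightarrow> 'a)"
  by (rule bounded_linear_intro[where K = 1]) (simp_all add: norm_re_im_le)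

lemma norm_Cplx_0 [simp]: "norm (Cplx x 0) = norm (x :: 'a::banach_lattice)"
  using norm_re_im_le(1,3)[of "Cplx x 0"] by simp

lemma bounded_linear_Cplx_0: "bounded_linear (\<lambda>x :: 'a::banach_lattice. Cplx x 0)"
  by (rule bounded_linear_intro[where K = 1]) (simp_all add: complexification_eq_iff)

lemma modulus_real: "modulus x 0 = \<bar>x :: 'a::banach_lattice\<bar>"
  using modulus_le_sum[of x 0] abs_le_modulus(1)[of x 0] by simp

lemma abs_le_imp_re_le: "\<bar>z\<bar> \<le> c *\<^sub>R u \<Longrightarrow> \<bar>re z\<bar> \<le> c *\<^sub>R re u"
  using abs_le_modulus(1)[of "re z" "im z"]
  by (auto simp: less_eq_complexification_def abs_complexification_def intro: order_trans)

text \<open>As u lies in E_u, some g in the ideal of v satisfies |u - g| \<le> u/2. Then u/2 is at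
  most the real part of g, which is at most a multiple of v.\<close>

lemma quasi_interior_point_dominates:
  fixes u v :: "'a::banach_lattice complexification"
  assumes u: "u \<in> pos_cone"
    and v: "quasi_interior_point (principal_ideal u) (gauge_norm u) v"
  obtains \<delta> where "\<delta> > 0" "\<delta> *\<^sub>R re u \<le> re v"
proof -
  have u0: "0 \<le> re u" "im u = 0"
    using u by (simp_all add: pos_cone_def less_eq_complexification_def)
  have abs_u: "\<bar>u\<bar> = u"
    using u0 by (simp add: abs_complexification_def modulus_real complexification_eq_iff)
  have uI: "u \<in> principal_ideal u"
    unfolding principal_ideal_def by (auto intro!: exI[of _ 1] simp: abs_u)
  have "\<exists>g\<in>principal_ideal u \<inter> principal_ideal v. gauge_norm u (u - g) < 1 / 2"
    using v uI unfolding quasi_interior_point_def by (metis half_gt_zero_iff zero_less_one)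
  then obtain g where g: "g \<in> principal_ideal u" "g \<in> principal_ideal v" "gauge_norm u (u - g) < 1 / 2"
    by blast
  obtain c where c: "c > 0" "\<bar>g\<bar> \<le> c *\<^sub>R v" using g(2) by (auto simp: principal_ideal_def)
  let ?X = "{c. c > 0 \<and> \<bar>u - g\<bar> \<le> c *\<^sub>R u}"
  \<comment> \<open>If \<open>?X\<close> were empty, the infimum \<open>gauge_norm u (u - g)\<close>
    would be a default value and carry no information.\<close>
  have "?X \<noteq> {}"
  proof -
    obtain b where b: "b > 0" "\<bar>g\<bar> \<le> b *\<^sub>R u" using g(1) by (auto simp: principal_ideal_def)
    have "modulus (- re g) (- im g) = modulus (re g) (im g)"
    proof (rule antisym)
      show "modulus (- re g) (- im g) \<le> modulus (re g) (im g)"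
        using modulus_scale_le[of "-1" "re g" "im g"] by simp
      show "modulus (re g) (im g) \<le> modulus (- re g) (- im g)"
        using modulus_scale_le[of "-1" "- re g" "- im g"] by simp
    qed
    then have "modulus (re u - re g) (im u - im g) \<le> re u + modulus (re g) (im g)"
      using modulus_triangle[of "re u" "- re g" "im u" "- im g"] u0 by (simp add: modulus_real)
    also have "\<dots> \<le> re u + b *\<^sub>R re u"
      using b by (simp add: less_eq_complexification_def abs_complexification_def)
    finally have "\<bar>u - g\<bar> \<le> (1 + b) *\<^sub>R u"
      using u0 by (simp add: less_eq_complexification_def abs_complexification_def scaleR_left_distrib)
    then show ?thesis using b by (auto intro!: exI[of _ "1 + b"])
  qed
  then obtain a where a: "a < 1 / 2" "\<bar>u - g\<bar> \<le> a *\<^sub>R u"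
    using cInf_lessD[of ?X "1 / 2"] g(3) by (auto simp: gauge_norm_def)
  have "re u - re g \<le> a *\<^sub>R re u"
    using abs_le_imp_re_le[OF a(2)] abs_ge_self order_trans by fastforce
  also have "\<dots> \<le> (1 / 2) *\<^sub>R re u" using a(1) u0 by (intro scaleR_right_mono) auto
  finally have "re u \<le> re g + (1 / 2) *\<^sub>R re u" by (simp add: algebra_simps)
  moreover have "re u = (1 / 2) *\<^sub>R re u + (1 / 2) *\<^sub>R re u" by (simp flip: scaleR_left_distrib)
  ultimately have "(1 / 2) *\<^sub>R re u \<le> re g" by (metis add_le_cancel_right)
  also have "\<dots> \<le> c *\<^sub>R re v" using abs_le_imp_re_le[OF c(2)] abs_ge_self order_trans by blast
  finally have "(1 / c) *\<^sub>R ((1 / 2) *\<^sub>R re u) \<le> (1 / c) *\<^sub>R (c *\<^sub>R re v)"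
    using c(1) by (intro scaleR_left_mono) simp_all
  then have "(1 / (2 * c)) *\<^sub>R re u \<le> re v" using c(1) by (simp add: mult.commute)
  then show ?thesis using that[of "1 / (2 * c)"] c(1) by simp
qed

text \<open>Lets irreducibility be tested on ideals of the real lattice. Instead of the modulus of
  z, its bound |re z| + |im z| is used, which visibly lies in J.\<close>

lemma lattice_ideal_of_real_ideal:
  assumes J: "real_ideal J"
  shows "lattice_ideal {z. re z \<in> J \<and> im z \<in> J}"
proof -
  have sub: "subspace J" and ideal: "\<And>x y. x \<in> J \<Longrightarrow> \<bar>y\<bar> \<le> \<bar>x\<bar> \<Longrightarrow> y \<in> J"
    using J by (auto simp: real_ideal_def)
  show ?thesis
    unfolding lattice_ideal_def
  proof (intro conjI ballI allI impI)
    show "csubspace {z. re z \<in> J \<and> im z \<in> J}"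
      by (rule cvs.subspaceI)
        (auto intro!: subspace_0[OF sub] subspace_add[OF sub] subspace_diff[OF sub] subspace_scale[OF sub])
    fix z w :: "'a complexification"
    assume z: "z \<in> {z. re z \<in> J \<and> im z \<in> J}" and "\<bar>w\<bar> \<le> \<bar>z\<bar>"
    then have wz: "modulus (re w) (im w) \<le> modulus (re z) (im z)"
      by (simp add: less_eq_complexification_def abs_complexification_def)
    let ?b = "\<bar>re z\<bar> + \<bar>im z\<bar>"
    have "?b \<in> J" using z by (intro subspace_add[OF sub]) (auto intro: ideal)
    moreover have "modulus (re w) (im w) \<le> \<bar>?b\<bar>"
      using wz modulus_le_sum[of "re z" "im z"] abs_ge_self[of ?b] by (meson order_trans)
    ultimately show "w \<in> {z. re z \<in> J \<and> im z \<in> J}"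
      using ideal[of ?b] abs_le_modulus(1)[of "re w" "im w"]
          abs_le_modulus(2)[where x = "re w" and y = "im w"] by (auto intro: order_trans)
  qed
qed

text \<open>\<open>nonzero\<close> rules out the zero space, where every complex number belongs to
  the resolvent set.\<close>

theorem theorem7p1:
  fixes T :: "real \<Rightarrow> 'a::banach_lattice complexification \<Rightarrow> 'a complexification"
    and u :: "'a complexification" and t\<^sub>0 :: real
  assumes nonzero: "\<exists>x :: 'a complexification. x \<noteq> 0"
    and semigroup: "C0_semigroup T"
    and real: "real_semigroup T"
    and positive: "uniformly_eventually_positive T"
    and irreducible: "persistently_irreducible T"
    and u: "u \<in> pos_cone" and t\<^sub>0: "t\<^sub>0 \<ge> 0"
    and range_T: "range (T t\<^sub>0) \<subseteq> principal_ideal u"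
    and quasi_interior:
      "\<exists>v \<in> range (T t\<^sub>0). quasi_interior_point (principal_ideal u) (gauge_norm u) v"
  shows "spectrum (generator_domain T) (generator T) \<noteq> {}"
proof
  assume empty: "spectrum (generator_domain T) (generator T) = {}"
  \<comment> \<open>The order arguments take place on the real lattice: a real operator acts on real
    and imaginary parts separately, through the same \<open>P t\<close>.\<close>
  define P where "P t x = re (T t (Cplx x 0))" for t x
  have T_real: "T t (Cplx x 0) = Cplx (P t x) 0" if "t \<ge> 0" for t x
  proof -
    have "T t (Cplx x 0) \<in> real_part"
      using real that unfolding real_semigroup_def real_operator_def
      by (force simp: real_part_def)
    then show ?thesis by (simp add: P_def real_part_def complexification_eq_iff)
  qed
  have T_eq: "T t z = Cplx (P t (re z)) (P t (im z))" if t: "t \<ge> 0" for t z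
  proof -
    have "T t z = T t (Cplx (re z) 0) + \<i> *\<^sub>C T t (Cplx (im z) 0)"
      using semigroup_bounded_linear[OF semigroup t] semigroup_clinear[OF semigroup t]
      by (subst Cplx_re_im) (simp add: linear_simps)
    then show ?thesis by (simp add: T_real[OF t] complexification_eq_iff)
  qed
  obtain t\<^sub>1 where t1: "t\<^sub>1 \<ge> 0" "\<And>t f. t \<ge> t\<^sub>1 \<Longrightarrow> 0 \<le> f \<Longrightarrow> 0 \<le> T t f"
    using positive unfolding uniformly_eventually_positive_def by blast
  interpret eventually_positive_irreducible P t\<^sub>1
  proof (rule eventually_positive_irreducible.intro)
    show "bounded_linear (P t)" if "t \<ge> 0" for t
      unfolding P_def[abs_def]
      by (intro bounded_linear_compose[OF bounded_linear_re]
          bounded_linear_compose[OF semigroup_bounded_linear[OF semigroup that] bounded_linear_Cplx_0])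
    show "P 0 x = x" for x by (simp add: P_def semigroup_0[OF semigroup])
    show "P (s + t) x = P s (P t x)" if "s \<ge> 0" "t \<ge> 0" for s t x
    proof -
      have "T (s + t) (Cplx x 0) = T s (T t (Cplx x 0))"
        by (rule semigroup_add[OF semigroup that])
      also have "\<dots> = Cplx (P s (P t x)) 0" by (simp only: T_real that)
      finally show ?thesis by (simp only: P_def[of "s + t"] complexification.sel)
    qed
    show "continuous_on {0..} (\<lambda>t. P t x)" for x
      unfolding P_def
      by (rule bounded_linear.continuous_on[OF bounded_linear_re semigroup_continuous_on[OF semigroup]])
    show "t\<^sub>1 \<ge> 0" by fact
    show "0 \<le> P t x" if "t \<ge> t\<^sub>1" "0 \<le> x" for t x
      using t1(2)[of t "Cplx x 0"] that by (simp add: less_eq_complexification_def P_def)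
    show "J = {0} \<or> J = UNIV"
      if J: "real_ideal J" "closed J" "s \<ge> 0" "\<And>t x. t \<ge> s \<Longrightarrow> x \<in> J \<Longrightarrow> P t x \<in> J" for J s
    proof -
      let ?I = "{z. re z \<in> J \<and> im z \<in> J}"
      have "closed ?I"
      proof -
        have "?I = re -` J \<inter> im -` J" by auto
        then show ?thesis
          using continuous_closed_vimage[OF J(2)] linear_continuous_at[OF bounded_linear_re]
            linear_continuous_at[OF bounded_linear_im] by (metis closed_Int)
      qed
      moreover have "\<forall>t\<ge>s. T t ` ?I \<subseteq> ?I" using J(3,4) by (auto simp: T_eq)
      ultimately have I: "?I = {0} \<or> ?I = UNIV"
        using irreducible lattice_ideal_of_real_ideal[OF J(1)] J(3)
        unfolding persistently_irreducible_def by blast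
      have J0: "0 \<in> J" using J(1) by (simp add: real_ideal_def subspace_0)
      then have *: "Cplx x 0 \<in> ?I \<longleftrightarrow> x \<in> J" for x by simp
      from I show ?thesis
      proof
        assume I: "?I = {0}"
        have "x = 0" if "x \<in> J" for x
          using that *[of x] unfolding I by (simp add: complexification_eq_iff)
        then show ?thesis using J0 by blast
      next
        assume "?I = UNIV"
        then show ?thesis using * by blast
      qed
    qed
  qed
  have u0: "0 \<le> re u" using u by (simp add: pos_cone_def less_eq_complexification_def)
  have nonzero': "\<exists>x::'a. x \<noteq> 0" using nonzero by (auto simp: complexification_eq_iff)
  have dom: "\<exists>c. \<bar>P t\<^sub>0 x\<bar> \<le> c *\<^sub>R re u" for x
  proof -
    obtain c where "\<bar>T t\<^sub>0 (Cplx x 0)\<bar> \<le> c *\<^sub>R u"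
      using range_T by (auto simp: principal_ideal_def)
    then show ?thesis unfolding P_def by (blast dest: abs_le_imp_re_le)
  qed
  obtain w where w: "quasi_interior_point (principal_ideal u) (gauge_norm u) (T t\<^sub>0 w)"
    using quasi_interior by blast
  then obtain \<delta> where \<delta>: "\<delta> > 0" "\<delta> *\<^sub>R re u \<le> P t\<^sub>0 (re w)"
    using quasi_interior_point_dominates[OF u w] T_eq[OF t\<^sub>0] by (metis complexification.sel(1))
  obtain U s \<tau> c where U: "0 \<le> U" "U \<noteq> 0" and c: "c > 0" and s\<tau>: "s \<ge> 0" "\<tau> \<ge> 0"
    and growth: "\<And>n. c ^ n *\<^sub>R U \<le> ((\<lambda>x. P s (integral {0..\<tau>} (\<lambda>t. P t x))) ^^ n) U"
    by (rule averaged_growth[OF nonzero' u0 t\<^sub>0 dom \<delta>]) (rule that)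
  let ?S = "\<lambda>x. P s (integral {0..\<tau>} (\<lambda>t. P t x))"
  let ?S' = "\<lambda>z. T s (integral {0..\<tau>} (\<lambda>t. T t z))"
  have "?S' (Cplx x 0) = Cplx (?S x) 0" for x
  proof -
    have "integral {0..\<tau>} (\<lambda>t. T t (Cplx x 0)) = integral {0..\<tau>} (\<lambda>t. Cplx (P t x) 0)"
      by (rule integral_cong) (simp add: T_real)
    also have "\<dots> = Cplx (integral {0..\<tau>} (\<lambda>t. P t x)) 0"
      using integral_linear[OF integrable[where x = x and a = 0 and b = \<tau>] bounded_linear_Cplx_0] by (simp add: o_def)
    finally show ?thesis by (simp add: T_real[OF s\<tau>(1)])
  qed
  then have S_iter: "(?S' ^^ n) (Cplx U 0) = Cplx ((?S ^^ n) U) 0" for n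
    by (induction n) simp_all
  \<comment> \<open>Any rate below c would do; c / 2 leaves the unbounded factor 2^n.\<close>
  have "c / 2 > 0" using c by simp
  then obtain C where C: "C \<ge> 0" "\<And>n. norm ((?S' ^^ n) (Cplx U 0)) \<le> C * (c / 2) ^ n"
    by (rule averaged_semigroup_quasinilpotent[OF semigroup empty s\<tau>, where x = "Cplx U 0"]) (rule that)
  have "2 ^ n * norm U \<le> C" for n
  proof -
    have "c ^ n * norm U = norm (c ^ n *\<^sub>R U)" using c by simp
    also have "\<dots> \<le> norm ((?S ^^ n) U)"
      using growth c U(1) by (intro norm_mono_nonneg scaleR_nonneg_nonneg) simp_all
    also have "\<dots> \<le> C * (c / 2) ^ n" using C(2)[of n] by (simp only: S_iter norm_Cplx_0)
    finally show ?thesis using c by (simp add: power_divide field_simps)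
  qed
  moreover obtain n where "C / norm U < 2 ^ n" using real_arch_pow[of 2 "C / norm U"] by auto
  ultimately show False using U(2) by (metis divide_less_eq not_le zero_less_norm_iff)
qed

end
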